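(* Let $\overline{n}=(n_1,\ldots,n_r)$ with $1\le n_1\le\cdots\le n_r$, and let $k$ be the number of indices $i$ with $2\le i\le r$ and $n_i$ even. Then $\mathrm{TC}(\mathrm{P}_{\overline{n}})<(\mathrm{TC}(\mathrm{P}^{n_1})+1)(r+k)$.
   Context: $\mathrm{P}_{\overline{n}}$ is the quotient of $S^{n_1}\times\cdots\times S^{n_r}$ by the diagonal $\mathbb{Z}_2$-action which is antipodal on each factor, and $\mathrm{P}^{n_1}$ is real projective space. $\mathrm{TC}$ denotes Farber's topological complexity in reduced form (one less than the minimal number of open sets in a cover of $X\times X$ by sets admitting continuous sections of the endpoint evaluation $X^{[0,1]}\to X\times X$). *)

theory Defs
  imports "HOL-Analysis.Analysis" "HOL-Library.Extended_Nat"
begin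

(* The unit sphere S^m, realised inside R^(m+1) = functions nat => real vanishing
   above index m, with the (product = Euclidean) topology. *)
definition sphere_set :: "nat \<Rightarrow> (nat \<Rightarrow> real) set" where
  "sphere_set m = {x. (\<forall>i>m. x i = 0) \<and> (\<Sum>i\<le>m. (x i)\<^sup>2) = 1}"

definition prod_spheres_set :: "(nat \<Rightarrow> nat) \<Rightarrow> nat \<Rightarrow> (nat \<Rightarrow> nat \<Rightarrow> real) set" where
  "prod_spheres_set n r = {x. (\<forall>j<r. x j \<in> sphere_set (n j)) \<and> (\<forall>j\<ge>r. x j = (\<lambda>_. 0))}"

definition prod_spheres :: "(nat \<Rightarrow> nat) \<Rightarrow> nat \<Rightarrow> (nat \<Rightarrow> nat \<Rightarrow> real) topology" where
  "prod_spheres n r =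
     subtopology (product_topology (\<lambda>j. powertop_real UNIV) UNIV) (prod_spheres_set n r)"

definition antipode :: "(nat \<Rightarrow> nat \<Rightarrow> real) \<Rightarrow> (nat \<Rightarrow> nat \<Rightarrow> real)" where
  "antipode x = (\<lambda>j i. - x j i)"

definition quotient_topology :: "'a topology \<Rightarrow> ('a \<Rightarrow> 'b) \<Rightarrow> 'b topology" where
  "quotient_topology X f =
     topology (\<lambda>U. U \<subseteq> f ` topspace X \<and> openin X {x \<in> topspace X. f x \<in> U})"

lemma istopology_quotient:
  fixes f :: "'a \<Rightarrow> 'b" and X :: "'a topology"
  shows "istopology (\<lambda>U. U \<subseteq> f ` topspace X \<and> openin X {x \<in> topspace X. f x \<in> U})"
  unfolding istopology_def
proof (rule conjI; intro allI impI)
  fix S T :: "'b set"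
  assume a: "S \<subseteq> f ` topspace X \<and> openin X {x \<in> topspace X. f x \<in> S}"
     and b: "T \<subseteq> f ` topspace X \<and> openin X {x \<in> topspace X. f x \<in> T}"
  have e: "{x \<in> topspace X. f x \<in> S \<inter> T} =
      {x \<in> topspace X. f x \<in> S} \<inter> {x \<in> topspace X. f x \<in> T}" by auto
  show "S \<inter> T \<subseteq> f ` topspace X \<and> openin X {x \<in> topspace X. f x \<in> S \<inter> T}"
    using a b openin_Int[of X "{x \<in> topspace X. f x \<in> S}" "{x \<in> topspace X. f x \<in> T}"]
    unfolding e by blast
next
  fix K :: "'b set set"
  assume K: "\<forall>S\<in>K. S \<subseteq> f ` topspace X \<and> openin X {x \<in> topspace X. f x \<in> S}"
  have "{x \<in> topspace X. f x \<in> \<Union>K} = (\<Union>S\<in>K. {x \<in> topspace X. f x \<in> S})" by auto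
  then show "\<Union>K \<subseteq> f ` topspace X \<and> openin X {x \<in> topspace X. f x \<in> \<Union>K}"
    using K by (auto intro!: openin_Union)
qed

definition proj_product :: "(nat \<Rightarrow> nat) \<Rightarrow> nat \<Rightarrow> (nat \<Rightarrow> nat \<Rightarrow> real) set topology" where
  "proj_product n r = quotient_topology (prod_spheres n r) (\<lambda>x. {x, antipode x})"

definition real_proj_space :: "nat \<Rightarrow> (nat \<Rightarrow> nat \<Rightarrow> real) set topology" where
  "real_proj_space m = proj_product (\<lambda>_. m) 1"

(* A motion planner (local section of the endpoint map X^[0,1] -> X x X) on U,
   given in adjoint form U x [0,1] -> X. *)
definition motion_planner :: "'a topology \<Rightarrow> ('a \<times> 'a) set \<Rightarrow> (('a \<times> 'a) \<times> real \<Rightarrow> 'a) \<Rightarrow> bool" where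
  "motion_planner X U s \<longleftrightarrow>
     continuous_map (prod_topology (subtopology (prod_topology X X) U) (top_of_set {0..1})) X s \<and>
     (\<forall>p\<in>U. s (p, 0) = fst p \<and> s (p, 1) = snd p)"

(* reduced topological complexity: least k such that X x X is covered by k+1 open
   sets each admitting a motion planner (infinity if none) *)
definition TC :: "'a topology \<Rightarrow> enat" where
  "TC X = Inf (enat ` {k. \<exists>U :: nat \<Rightarrow> ('a \<times> 'a) set.
      (\<forall>i\<le>k. openin (prod_topology X X) (U i) \<and> (\<exists>s. motion_planner X (U i) s)) \<and>
      topspace (prod_topology X X) \<subseteq> (\<Union>i\<le>k. U i)})"

end

theory Submission
  imports Defs
begin

text \<open>
  A motion planner on projective space lifts through the double cover: a chosen representative
  \<open>x\<^sub>0\<close> yields a path of the sphere from \<open>x\<^sub>0\<close> to \<open>\<plusminus>y\<^sub>0\<close>, and this sign singles out, equivariantly, a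
  representative of the second end point in all factors. It remains to move from \<open>x\<^sub>j\<close> to \<open>y\<^sub>j\<close> in the
  other spheres by rules commuting with the antipode. Straight lines fail exactly where
  \<open>x\<^sub>j = -y\<^sub>j\<close>; there one follows a skew linear vector field at \<open>y\<^sub>j\<close>, which on an even sphere vanishes
  exactly at \<open>\<plusminus>e\<^sub>n\<close>, and a third rule is available there. Thus one or two continuous
  functions with values at most \<open>1\<close>, the defects, measure for every factor \<open>j \<ge> 1\<close> how close one is to such a
  failure, which occurs at the value \<open>1\<close>. There are \<open>r - 1 + k\<close> defects. For a set \<open>D\<close> of defects, the
  points whose defects in \<open>D\<close> are positive and exceed all others, which are below \<open>1\<close>, form an open
  set with a motion planner. These sets are disjoint for distinct \<open>D\<close> of equal cardinality,
  so each cardinality between \<open>0\<close> and \<open>r - 1 + k\<close> contributes only one open set.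
\<close>

subsection \<open>The quotient by the antipodal action\<close>

definition proj_point :: "(nat \<Rightarrow> nat \<Rightarrow> real) \<Rightarrow> (nat \<Rightarrow> nat \<Rightarrow> real) set" where
  "proj_point x = {x, antipode x}"

lemma antipode_apply [simp]: "antipode x j i = - x j i"
  by (simp add: antipode_def)

lemma antipode_antipode [simp]: "antipode (antipode x) = x"
  by (simp add: antipode_def)

lemma proj_point_eq_iff: "proj_point x = proj_point y \<longleftrightarrow> x = y \<or> x = antipode y"
  unfolding proj_point_def by (metis antipode_antipode doubleton_eq_iff)

lemma proj_point_antipode [simp]: "proj_point (antipode x) = proj_point x"
  by (simp add: proj_point_eq_iff)

lemma antipode_in_prod_spheres_set [simp]:
  "antipode x \<in> prod_spheres_set n r \<longleftrightarrow> x \<in> prod_spheres_set n r"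
  by (auto simp: prod_spheres_set_def sphere_set_def fun_eq_iff)

lemma prod_spheres_eq: "prod_spheres n r = top_of_set (prod_spheres_set n r)"
  by (simp add: prod_spheres_def euclidean_product_topology)

lemma openin_quotient_topology:
  "openin (quotient_topology X f) U \<longleftrightarrow>
     U \<subseteq> f ` topspace X \<and> openin X {x \<in> topspace X. f x \<in> U}"
  by (simp add: quotient_topology_def istopology_quotient)

lemma topspace_quotient_topology: "topspace (quotient_topology X f) = f ` topspace X"
proof (rule antisym)
  show "topspace (quotient_topology X f) \<subseteq> f ` topspace X"
    by (metis openin_quotient_topology openin_topspace)
  have "{x \<in> topspace X. f x \<in> f ` topspace X} = topspace X"
    by auto
  then have "openin (quotient_topology X f) (f ` topspace X)"
    by (simp add: openin_quotient_topology)
  then show "f ` topspace X \<subseteq> topspace (quotient_topology X f)"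
    by (rule openin_subset)
qed

lemma quotient_map_quotient_topology: "quotient_map X (quotient_topology X f) f"
  by (auto simp: quotient_map_def topspace_quotient_topology openin_quotient_topology)

lemma proj_product_eq: "proj_product n r = quotient_topology (top_of_set (prod_spheres_set n r)) proj_point"
  unfolding proj_product_def prod_spheres_eq by (simp add: proj_point_def[abs_def])

lemma topspace_proj_product: "topspace (proj_product n r) = proj_point ` prod_spheres_set n r"
  by (simp add: proj_product_eq topspace_quotient_topology)

lemma continuous_on_coordinate2:
  fixes f :: "'a::topological_space \<Rightarrow> nat \<Rightarrow> nat \<Rightarrow> real"
  assumes "continuous_on A f"
  shows "continuous_on A (\<lambda>x. f x j i)"
  by (rule continuous_on_product_then_coordinatewise[OF continuous_on_product_then_coordinatewise[OF assms]])

lemma continuous_on_antipode: "continuous_on A antipode"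
  unfolding antipode_def
  by (rule continuous_on_coordinatewise_then_product, rule continuous_on_coordinatewise_then_product)
    (rule continuous_on_minus[OF continuous_on_coordinate2[OF continuous_on_id]])

lemma quotient_map_proj_point:
  "quotient_map (top_of_set (prod_spheres_set n r)) (proj_product n r) proj_point"
  unfolding proj_product_eq by (rule quotient_map_quotient_topology)

lemma continuous_map_proj_point:
  "continuous_map (top_of_set (prod_spheres_set n r)) (proj_product n r) proj_point"
  using quotient_map_proj_point quotient_imp_continuous_map by blast

text \<open>The saturation of an open \<open>U\<close> is the union of \<open>U\<close> and its
  preimage under the antipode, and both are open.\<close>

lemma open_map_proj_point: "open_map (top_of_set (prod_spheres_set n r)) (proj_product n r) proj_point"
  unfolding open_map_def
proof (intro allI impI)
  let ?S = "prod_spheres_set n r"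
  fix U assume U: "openin (top_of_set ?S) U"
  then have US: "U \<subseteq> ?S" by (simp add: openin_imp_subset)
  have "openin (top_of_set ?S) (?S \<inter> antipode -` U)"
    by (rule continuous_openin_preimage[OF continuous_on_antipode _ U]) auto
  moreover have "{x \<in> ?S. proj_point x \<in> proj_point ` U} = U \<union> (?S \<inter> antipode -` U)"
  proof (intro set_eqI iffI)
    fix x assume "x \<in> {x \<in> ?S. proj_point x \<in> proj_point ` U}"
    then obtain y where "x \<in> ?S" "y \<in> U" "x = y \<or> x = antipode y"
      unfolding image_iff mem_Collect_eq proj_point_eq_iff by blast
    then show "x \<in> U \<union> (?S \<inter> antipode -` U)" by auto
  next
    fix x assume "x \<in> U \<union> (?S \<inter> antipode -` U)"
    moreover have "proj_point x = proj_point (antipode x)" by simp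
    ultimately show "x \<in> {x \<in> ?S. proj_point x \<in> proj_point ` U}"
      using US by blast
  qed
  ultimately have "openin (top_of_set ?S) {x \<in> ?S. proj_point x \<in> proj_point ` U}"
    using U by (simp add: openin_Un)
  then show "openin (proj_product n r) (proj_point ` U)"
    using US unfolding proj_product_eq openin_quotient_topology
    by (simp add: image_mono)
qed

section \<open>Products of open maps and descent of motion planners to the quotient\<close>

lemma open_map_map_prod:
  assumes f: "open_map X X' f" and g: "open_map Y Y' g"
  shows "open_map (prod_topology X Y) (prod_topology X' Y') (map_prod f g)"
  unfolding open_map_def
proof (intro allI impI)
  fix W assume W: "openin (prod_topology X Y) W"
  show "openin (prod_topology X' Y') (map_prod f g ` W)"
    unfolding openin_prod_topology_alt
  proof (intro allI impI)
    fix a b assume "(a, b) \<in> map_prod f g ` W"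
    then obtain x y where xy: "(x, y) \<in> W" "a = f x" "b = g y" by auto
    then obtain U V where "openin X U" "openin Y V" "x \<in> U" "y \<in> V" "U \<times> V \<subseteq> W"
      using W unfolding openin_prod_topology_alt by meson
    moreover have "f ` U \<times> g ` V = map_prod f g ` (U \<times> V)"
      by (rule map_prod_surj_on[OF refl refl, symmetric])
    ultimately show "\<exists>U V. openin X' U \<and> openin Y' V \<and> a \<in> U \<and> b \<in> V \<and> U \<times> V \<subseteq> map_prod f g ` W"
      using f g xy unfolding open_map_def by (metis image_eqI image_mono)
  qed
qed

lemma continuous_map_map_prod:
  assumes "continuous_map X X' f" "continuous_map Y Y' g"
  shows "continuous_map (prod_topology X Y) (prod_topology X' Y') (map_prod f g)"
proof -
  have "continuous_map (prod_topology X Y) X' (f \<circ> fst)"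
    by (rule continuous_map_compose[OF continuous_map_fst assms(1)])
  moreover have "continuous_map (prod_topology X Y) Y' (g \<circ> snd)"
    by (rule continuous_map_compose[OF continuous_map_snd assms(2)])
  ultimately show ?thesis
    by (simp add: map_prod_def case_prod_unfold continuous_map_pairwise o_def)
qed

text \<open>A motion planner on the quotient is a map upstairs that is invariant, up to the antipodal
  action on its values, under changing the sign of either end point.\<close>

lemma motion_planner_from_lift:
  fixes n r and G :: "((nat \<Rightarrow> nat \<Rightarrow> real) \<times> (nat \<Rightarrow> nat \<Rightarrow> real)) \<times> real \<Rightarrow> nat \<Rightarrow> nat \<Rightarrow> real"
  defines "S \<equiv> prod_spheres_set n r"
  assumes W: "openin (top_of_set (S \<times> S)) W"
    and inv1: "\<And>x y. (x, y) \<in> W \<Longrightarrow> (antipode x, y) \<in> W"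
    and inv2: "\<And>x y. (x, y) \<in> W \<Longrightarrow> (x, antipode y) \<in> W"
    and G: "continuous_on (W \<times> {0..1}) G" "G ` (W \<times> {0..1}) \<subseteq> S"
    and G0: "\<And>x y. (x, y) \<in> W \<Longrightarrow> proj_point (G ((x, y), 0)) = proj_point x"
    and G1: "\<And>x y. (x, y) \<in> W \<Longrightarrow> proj_point (G ((x, y), 1)) = proj_point y"
    and Ginv1: "\<And>x y t. (x, y) \<in> W \<Longrightarrow> t \<in> {0..1} \<Longrightarrow> proj_point (G ((antipode x, y), t)) = proj_point (G ((x, y), t))"
    and Ginv2: "\<And>x y t. (x, y) \<in> W \<Longrightarrow> t \<in> {0..1} \<Longrightarrow> proj_point (G ((x, antipode y), t)) = proj_point (G ((x, y), t))"
  defines "P \<equiv> proj_product n r"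
  defines "U \<equiv> map_prod proj_point proj_point ` W"
  shows "openin (prod_topology P P) U" and "\<exists>s. motion_planner P U s"
proof -
  let ?I = "top_of_set {0..1::real}"
  have omap: "open_map (prod_topology (top_of_set S) (top_of_set S)) (prod_topology P P) (map_prod proj_point proj_point)"
    unfolding P_def S_def by (intro open_map_map_prod open_map_proj_point)
  have cmap: "continuous_map (prod_topology (top_of_set S) (top_of_set S)) (prod_topology P P) (map_prod proj_point proj_point)"
    unfolding P_def S_def by (intro continuous_map_map_prod continuous_map_proj_point)
  have WS: "W \<subseteq> S \<times> S" using W by (rule openin_imp_subset)
  show opU: "openin (prod_topology P P) U"
    using omap W unfolding open_map_def U_def by simp
  \<comment> \<open>\<open>W\<close> is saturated: by \<open>inv1\<close> and \<open>inv2\<close> it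
    contains all four sign changes of each of its pairs. Hence open maps restrict to
    \<open>W\<close> over \<open>U\<close>.\<close>
  have UW: "{z \<in> S \<times> S. map_prod proj_point proj_point z \<in> U} = W"
  proof (intro set_eqI iffI; clarify)
    fix x y assume "map_prod proj_point proj_point (x, y) \<in> U"
    then obtain w where w: "w \<in> W" "map_prod proj_point proj_point (x, y) = map_prod proj_point proj_point w"
      unfolding U_def by (elim imageE)
    obtain x' y' where "w = (x', y')" by (rule prod.exhaust)
    with w have *: "(x', y') \<in> W" "proj_point x = proj_point x'" "proj_point y = proj_point y'"
      by (simp_all only: map_prod_simp prod.inject)
    then have "x = x' \<or> x = antipode x'" "y = y' \<or> y = antipode y'"
      by (simp_all only: proj_point_eq_iff)
    then show "(x, y) \<in> W"
      using *(1) inv1[OF *(1)] inv2[OF *(1)] inv2[OF inv1[OF *(1)]] by (elim disjE) simp_all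
  next
    fix x y assume "(x, y) \<in> W"
    then show "(x, y) \<in> S \<times> S \<and> map_prod proj_point proj_point (x, y) \<in> U"
      using WS unfolding U_def by blast
  qed
  have "open_map (subtopology (prod_topology (top_of_set S) (top_of_set S)) W) (subtopology (prod_topology P P) U) (map_prod proj_point proj_point)"
    by (rule open_map_restriction[OF omap]) (use UW in simp)
  then have o2: "open_map (top_of_set W) (subtopology (prod_topology P P) U) (map_prod proj_point proj_point)"
    using WS by (simp add: subtopology_subtopology Int_absorb1)
  have "continuous_map (subtopology (prod_topology (top_of_set S) (top_of_set S)) W) (subtopology (prod_topology P P) U) (map_prod proj_point proj_point)"
    unfolding continuous_map_in_subtopology using cmap U_def by (auto intro: continuous_map_from_subtopology)
  then have c2: "continuous_map (top_of_set W) (subtopology (prod_topology P P) U) (map_prod proj_point proj_point)"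
    using WS by (simp add: subtopology_subtopology Int_absorb1)
  let ?Q = "map_prod (map_prod proj_point proj_point) id :: _ \<times> real \<Rightarrow> _"
  let ?T = "prod_topology (subtopology (prod_topology P P) U) ?I"
  \<comment> \<open>A product of quotient maps need not be a quotient map, but a product of open
    maps is open. Openness of the projection is what carries the quotient property over to pairs of
    points together with the time parameter.\<close>
  have Q: "quotient_map (top_of_set (W \<times> {0..1})) ?T ?Q"
  proof (rule continuous_open_imp_quotient_map)
    show "continuous_map (top_of_set (W \<times> {0..1})) ?T ?Q"
      using continuous_map_map_prod[OF c2 continuous_map_id[of ?I]] by simp
    show "open_map (top_of_set (W \<times> {0..1})) ?T ?Q"
      using open_map_map_prod[OF o2 open_map_id[of ?I]] by simp
    have "topspace (prod_topology P P) \<inter> U = U" using openin_subset[OF opU] by auto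
    then show "?Q ` topspace (top_of_set (W \<times> {0..1})) = topspace ?T"
      unfolding U_def by (simp add: map_prod_surj_on)
  qed
  \<comment> \<open>The planner evaluates \<open>G\<close> at an arbitrary preimage. By
    \<open>inv\<close> the class of the result is independent of the choice, so that continuity
    follows from the universal property of the quotient.\<close>
  define s where "s p = proj_point (G (SOME w. w \<in> W \<times> {0..1} \<and> ?Q w = p))" for p
  have inv: "proj_point (G w) = proj_point (G w')" if w01: "w \<in> W \<times> {0..1}" and QQ: "?Q w = ?Q w'" for w w'
  proof -
    obtain x y t where w: "w = ((x, y), t)" by (metis surj_pair)
    obtain x' y' t' where w': "w' = ((x', y'), t')" by (metis surj_pair)
    have eqs: "proj_point x' = proj_point x" "proj_point y' = proj_point y" "t' = t"
      using QQ unfolding w w' by (simp_all only: map_prod_simp prod.inject id_apply)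
    then have xy: "x' = x \<or> x' = antipode x" "y' = y \<or> y' = antipode y"
      by (simp_all only: proj_point_eq_iff)
    have 1: "(x, y) \<in> W" "t \<in> {0..1}" "(antipode x, y) \<in> W"
      using w01 inv1 w by auto
    have "proj_point (G ((x', y'), t)) = proj_point (G ((x, y), t))"
      using xy Ginv1[OF 1(1,2)] Ginv2[OF 1(1,2)] Ginv2[OF 1(3,2)] by (elim disjE) simp_all
    then show ?thesis
      unfolding w w' eqs(3) by (rule sym)
  qed
  have sQ: "s (?Q w) = proj_point (G w)" if "w \<in> W \<times> {0..1}" for w
  proof -
    define w' where "w' = (SOME v. v \<in> W \<times> {0..1} \<and> ?Q v = ?Q w)"
    have "w' \<in> W \<times> {0..1} \<and> ?Q w' = ?Q w"
      unfolding w'_def by (rule someI[of _ w]) (use that in simp)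
    then show ?thesis
      unfolding s_def w'_def[symmetric] by (intro inv) auto
  qed
  have "continuous_map (top_of_set (W \<times> {0..1})) P (proj_point \<circ> G)"
    using G unfolding P_def S_def by (intro continuous_map_compose[OF _ continuous_map_proj_point]) auto
  then have "continuous_map (top_of_set (W \<times> {0..1})) P (s \<circ> ?Q)"
    by (rule continuous_map_eq) (simp add: sQ)
  then have "continuous_map ?T P s"
    by (rule continuous_compose_quotient_map[OF Q])
  moreover have "s (p, 0) = fst p \<and> s (p, 1) = snd p" if "p \<in> U" for p
  proof -
    obtain x y where xy: "(x, y) \<in> W" "p = (proj_point x, proj_point y)" using \<open>p \<in> U\<close> unfolding U_def by auto
    show ?thesis using sQ[of "((x, y), 0)"] sQ[of "((x, y), 1)"] G0[OF xy(1)] G1[OF xy(1)] xy by simp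
  qed
  ultimately show "\<exists>s. motion_planner P U s"
    unfolding motion_planner_def by blast
qed

subsection \<open>Homotopy lifting along the double cover\<close>

lemma prod_spheres_setD:
  assumes "x \<in> prod_spheres_set n r" "j < r"
  shows "(\<Sum>i\<le>n j. (x j i)\<^sup>2) = 1" "\<And>i. i > n j \<Longrightarrow> x j i = 0"
  using assms by (auto simp: prod_spheres_set_def sphere_set_def)

lemma prod_spheres_set_nonzero_coordinate:
  assumes "x \<in> prod_spheres_set n r" "j < r"
  obtains i where "i \<le> n j" "x j i \<noteq> 0"
proof -
  have "\<exists>i\<le>n j. x j i \<noteq> 0"
  proof (rule ccontr)
    assume "\<not> ?thesis"
    then have "(\<Sum>i\<le>n j. (x j i)\<^sup>2) = 0" by simp
    with prod_spheres_setD(1)[OF assms] show False by simp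
  qed
  then show thesis using that by blast
qed

definition dot :: "nat \<Rightarrow> (nat \<Rightarrow> real) \<Rightarrow> (nat \<Rightarrow> real) \<Rightarrow> real" where
  "dot m x y = (\<Sum>i\<le>m. x i * y i)"

lemma dot_self:
  assumes "x \<in> prod_spheres_set n r" "j < r"
  shows "dot (n j) (x j) (x j) = 1"
  using prod_spheres_setD(1)[OF assms] by (simp add: dot_def power2_eq_square)

lemma dot_antipode:
  "dot m (antipode x j) y = - dot m (x j) y" "dot m y (antipode x j) = - dot m y (x j)"
  by (simp_all add: dot_def sum_negf)

lemma continuous_on_dot:
  fixes f g :: "'a::topological_space \<Rightarrow> nat \<Rightarrow> nat \<Rightarrow> real"
  assumes "continuous_on A f" "continuous_on A g"
  shows "continuous_on A (\<lambda>x. dot m (f x j) (g x j))"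
  unfolding dot_def
  by (intro continuous_on_sum continuous_on_mult continuous_on_coordinate2 assms)

text \<open>This is the sheet detector of the double cover: an inner product in factor 0 decides
  continuously whether two lifts of one point coincide or are antipodal.\<close>

lemma dot_proj_point_eq:
  assumes "x \<in> prod_spheres_set n r" "0 < r" "proj_point x = proj_point y"
  shows "dot (n 0) (x 0) (y 0) = (if x = y then 1 else -1)"
proof (cases "x = y")
  case False
  then have "y = antipode x" using assms(3) by (metis proj_point_eq_iff antipode_antipode)
  then show ?thesis using False dot_self[OF assms(1,2)] by (simp add: dot_antipode)
qed (use dot_self[OF assms(1,2)] in simp)

text \<open>The inner product of the two lifts in factor 0 is continuous with values in {1, -1},
  hence constant on the connected set \<open>T\<close>, and it equals 1 at
  \<open>t0\<close>.\<close>

lemma lift_unique: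
  assumes "0 < r" "connected T"
    and f: "continuous_on T f" "f ` T \<subseteq> prod_spheres_set n r" and g: "continuous_on T g"
    and eq: "\<And>t. t \<in> T \<Longrightarrow> proj_point (f t) = proj_point (g t)"
    and t0: "t0 \<in> T" "f t0 = g t0" and t: "t \<in> T"
  shows "f t = g t"
proof -
  let ?d = "\<lambda>t. dot (n 0) (f t 0) (g t 0)"
  have d: "?d t = (if f t = g t then 1 else -1)" if "t \<in> T" for t
    using dot_proj_point_eq[of "f t" n r "g t"] eq that f(2) \<open>0 < r\<close> by auto
  have "continuous_on T ?d" using f(1) g by (rule continuous_on_dot)
  moreover have "finite (?d ` T)"
    by (rule finite_subset[of _ "{1, -1}"]) (auto simp: d)
  ultimately have "?d constant_on T"
    using assms(2) by (intro continuous_finite_range_constant)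
  then have "?d t = ?d t0" using t t0(1) unfolding constant_on_def by auto
  then show ?thesis using d[OF t] d[OF t0(1)] t0(2) by (auto split: if_splits)
qed

text \<open>Where coordinate \<open>i\<close> of factor 0 does not vanish, each class has exactly
  one representative with that coordinate positive, and this representative depends continuously on
  the class.\<close>

lemma local_section:
  fixes n r i
  defines "S \<equiv> prod_spheres_set n r" and "P \<equiv> proj_product n r"
  assumes "0 < r"
  defines "C \<equiv> proj_point ` {x \<in> S. x 0 i \<noteq> 0}"
  shows "openin P C"
    and "\<exists>\<sigma>. continuous_map (subtopology P C) (top_of_set S) \<sigma> \<and> (\<forall>A\<in>C. proj_point (\<sigma> A) = A)"
proof -
  have op: "openin (top_of_set S) {x \<in> S. x 0 i \<noteq> 0}"
  proof -
    have "openin (top_of_set S) (S \<inter> (\<lambda>x. x 0 i) -` (- {0}))"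
      by (rule continuous_openin_preimage_gen[OF continuous_on_coordinate2[OF continuous_on_id]]) auto
    also have "S \<inter> (\<lambda>x. x 0 i) -` (- {0}) = {x \<in> S. x 0 i \<noteq> 0}" by auto
    finally show ?thesis .
  qed
  then show opO: "openin P C"
    using open_map_proj_point unfolding C_def P_def S_def open_map_def by blast
  have pre: "{x \<in> S. proj_point x \<in> C} = {x \<in> S. x 0 i \<noteq> 0}"
  proof (intro set_eqI iffI)
    fix x assume "x \<in> {x \<in> S. proj_point x \<in> C}"
    then obtain y where "x \<in> S" "y 0 i \<noteq> 0" "x = y \<or> x = antipode y"
      unfolding C_def image_iff mem_Collect_eq proj_point_eq_iff by blast
    then show "x \<in> {x \<in> S. x 0 i \<noteq> 0}" by auto
  qed (auto simp: C_def)
  have Q: "quotient_map (subtopology (top_of_set S) {x \<in> S. x 0 i \<noteq> 0}) (subtopology P C) proj_point"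
    unfolding P_def S_def
    by (rule quotient_map_restriction[OF quotient_map_proj_point])
      (use pre opO in \<open>simp_all add: S_def P_def\<close>)
  have sub: "subtopology (top_of_set S) {x \<in> S. x 0 i \<noteq> 0} = top_of_set {x \<in> S. x 0 i \<noteq> 0}"
    by (simp add: subtopology_subtopology Int_absorb1 Collect_subset)
  \<comment> \<open>Multiplying by the sign of the coordinate selects the positive representative.
    The result is unchanged under the antipode, so the description in \<open>\<sigma>\<close> below
    determines a unique point.\<close>
  define g :: "(nat \<Rightarrow> nat \<Rightarrow> real) \<Rightarrow> nat \<Rightarrow> nat \<Rightarrow> real" where "g x = (\<lambda>j k. sgn (x 0 i) * x j k)" for x
  have g: "g x = (if x 0 i > 0 then x else antipode x)" if "x 0 i \<noteq> 0" for x
    using that by (auto simp: g_def fun_eq_iff)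
  define \<sigma> where "\<sigma> A = (THE x. \<exists>y\<in>S. y 0 i \<noteq> 0 \<and> proj_point y = A \<and> x = g y)" for A
  have s: "\<sigma> (proj_point x) = g x" if "x \<in> S" "x 0 i \<noteq> 0" for x
    unfolding \<sigma>_def
  proof (rule the_equality)
    fix z assume "\<exists>y\<in>S. y 0 i \<noteq> 0 \<and> proj_point y = proj_point x \<and> z = g y"
    then obtain y where "y 0 i \<noteq> 0" "y = x \<or> y = antipode x" "z = g y"
      unfolding proj_point_eq_iff by blast
    then show "z = g x" using that by (auto simp: g_def fun_eq_iff sgn_if)
  qed (use that in blast)
  have "continuous_on {x \<in> S. x 0 i \<noteq> 0} g"
    unfolding g_def
    by (rule continuous_on_coordinatewise_then_product, rule continuous_on_coordinatewise_then_product)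
      (intro continuous_on_mult continuous_on_sgn continuous_on_coordinate2 continuous_on_id, auto)
  moreover have "g ` {x \<in> S. x 0 i \<noteq> 0} \<subseteq> S"
    using g by (auto simp: S_def)
  ultimately have "continuous_map (top_of_set {x \<in> S. x 0 i \<noteq> 0}) (top_of_set S) g"
    by auto
  then have "continuous_map (subtopology (top_of_set S) {x \<in> S. x 0 i \<noteq> 0}) (top_of_set S) (\<sigma> \<circ> proj_point)"
    unfolding sub by (rule continuous_map_eq) (auto simp: s)
  then have "continuous_map (subtopology P C) (top_of_set S) \<sigma>"
    by (rule continuous_compose_quotient_map[OF Q])
  moreover have "\<forall>A\<in>C. proj_point (\<sigma> A) = A"
    unfolding C_def using s g by auto
  ultimately show "\<exists>\<sigma>. continuous_map (subtopology P C) (top_of_set S) \<sigma> \<and> (\<forall>A\<in>C. proj_point (\<sigma> A) = A)"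
    by blast
qed

text \<open>The time interval is exhausted by Bolzano's bisection principle: short intervals are
  handled by a local section, and lifts over adjacent intervals are concatenated after shrinking the
  neighbourhood of \<open>z0\<close>.\<close>

lemma local_lift:
  fixes Z :: "'a::topological_space set" and h :: "'a \<times> real \<Rightarrow> _" and n r
  defines "S \<equiv> prod_spheres_set n r"
  assumes "0 < r"
    and h: "continuous_map (top_of_set (Z \<times> {0..1})) (proj_product n r) h"
    and z0: "z0 \<in> Z"
  shows "\<exists>V H. openin (top_of_set Z) V \<and> z0 \<in> V \<and> continuous_on (V \<times> {0..1}) H \<and>
           H ` (V \<times> {0..1}) \<subseteq> S \<and> (\<forall>w\<in>V \<times> {0..1}. proj_point (H w) = h w)"
proof -
  let ?P = "proj_product n r" and ?I = "{0..1::real}"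
  define Q where "Q a b \<longleftrightarrow> (0 \<le> a \<and> b \<le> 1 \<longrightarrow> 
      (\<exists>V H. openin (top_of_set Z) V \<and> z0 \<in> V \<and> continuous_on (V \<times> {a..b}) H \<and>
           H ` (V \<times> {a..b}) \<subseteq> S \<and> (\<forall>w\<in>V \<times> {a..b}. proj_point (H w) = h w)))" for a b
  have "(0::real) \<le> 1" by simp
  then have "Q 0 1"
  proof (induction rule: Bolzano)
    case (trans a b c)
    note [arith] = \<open>a \<le> b\<close> \<open>b \<le> c\<close>
    show ?case
      unfolding Q_def
    proof (intro impI)
      assume ac: "0 \<le> a \<and> c \<le> 1"
      then obtain V1 H1 where V1: "openin (top_of_set Z) V1" "z0 \<in> V1"
        and H1: "continuous_on (V1 \<times> {a..b}) H1" "H1 ` (V1 \<times> {a..b}) \<subseteq> S"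
          "\<And>w. w \<in> V1 \<times> {a..b} \<Longrightarrow> proj_point (H1 w) = h w"
        using \<open>Q a b\<close> \<open>b \<le> c\<close> unfolding Q_def by auto
      obtain V2 H2 where V2: "openin (top_of_set Z) V2" "z0 \<in> V2"
        and H2: "continuous_on (V2 \<times> {b..c}) H2" "H2 ` (V2 \<times> {b..c}) \<subseteq> S"
          "\<And>w. w \<in> V2 \<times> {b..c} \<Longrightarrow> proj_point (H2 w) = h w"
        using ac \<open>Q b c\<close> \<open>a \<le> b\<close> unfolding Q_def by auto
      have "proj_point (H1 (z0, b)) = proj_point (H2 (z0, b))"
        using H1(3)[of "(z0, b)"] H2(3)[of "(z0, b)"] V1 V2 trans by simp
      \<comment> \<open>At (\<open>z0\<close>, \<open>b\<close>) the second lift agrees with the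
        first or is its antipode; in the latter case it is replaced by its antipode.\<close>
      then have "\<exists>H3. continuous_on (V2 \<times> {b..c}) H3 \<and> H3 ` (V2 \<times> {b..c}) \<subseteq> S \<and>
          (\<forall>w \<in> V2 \<times> {b..c}. proj_point (H3 w) = h w) \<and> H1 (z0, b) = H3 (z0, b)"
        unfolding proj_point_eq_iff
      proof
        assume "H1 (z0, b) = H2 (z0, b)"
        then show ?thesis using H2 by blast
      next
        assume *: "H1 (z0, b) = antipode (H2 (z0, b))"
        have "continuous_on (V2 \<times> {b..c}) (antipode \<circ> H2)"
          by (intro continuous_on_compose H2 continuous_on_antipode)
        moreover have "(antipode \<circ> H2) ` (V2 \<times> {b..c}) \<subseteq> S"
          using H2(2) unfolding S_def by force
        moreover have "\<forall>w \<in> V2 \<times> {b..c}. proj_point ((antipode \<circ> H2) w) = h w"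
          using H2(3) by simp
        ultimately show ?thesis using * by (intro exI[of _ "antipode \<circ> H2"]) simp
      qed
      then obtain H3 where H3: "continuous_on (V2 \<times> {b..c}) H3" "H3 ` (V2 \<times> {b..c}) \<subseteq> S"
          "\<And>w. w \<in> V2 \<times> {b..c} \<Longrightarrow> proj_point (H3 w) = h w" and eq: "H1 (z0, b) = H3 (z0, b)"
        by blast
      let ?d = "\<lambda>z. dot (n 0) (H1 (z, b) 0) (H3 (z, b) 0)"
      have d: "?d z = (if H1 (z, b) = H3 (z, b) then 1 else -1)" if "z \<in> V1 \<inter> V2" for z
        by (rule dot_proj_point_eq[where r=r])
          (use H1 H3 that trans \<open>0 < r\<close> in \<open>auto simp: image_subset_iff S_def\<close>)
      \<comment> \<open>The lifts agree at time \<open>b\<close> for \<open>z0\<close>, but possibly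
        not for all nearby points. Positivity of the sheet detector is an open condition that forces
        the value 1, that is, agreement.\<close>
      define V where "V = (V1 \<inter> V2) \<inter> ?d -` {0<..}"
      have V12: "openin (top_of_set Z) (V1 \<inter> V2)" using V1 V2 by blast
      have c1: "continuous_on (V1 \<inter> V2) (\<lambda>z. H1 (z, b))"
        by (rule continuous_on_compose2[OF H1(1)]) (use trans in \<open>auto intro!: continuous_intros\<close>)
      have c3: "continuous_on (V1 \<inter> V2) (\<lambda>z. H3 (z, b))"
        by (rule continuous_on_compose2[OF H3(1)]) (use trans in \<open>auto intro!: continuous_intros\<close>)
      have "openin (top_of_set (V1 \<inter> V2)) V"
        unfolding V_def by (intro continuous_openin_preimage_gen continuous_on_dot c1 c3) simp
      then have V: "openin (top_of_set Z) V" using V12 openin_trans by blast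
      have z0V: "z0 \<in> V" using V1 V2 d[of z0] eq by (simp add: V_def)
      have Vsub: "V \<subseteq> V1" "V \<subseteq> V2" by (auto simp: V_def)
      have Veq: "H1 (z, b) = H3 (z, b)" if "z \<in> V" for z
        using d[of z] that by (auto simp: V_def split: if_splits)
      define H where "H w = (if snd w \<le> b then H1 w else H3 w)" for w
      have "continuous_on (V \<times> {a..c}) H"
        unfolding H_def
      proof (rule continuous_on_cases_le)
        show "continuous_on {x \<in> V \<times> {a..c}. snd x \<le> b} H1"
          by (rule continuous_on_subset[OF H1(1)]) (use Vsub in auto)
        show "continuous_on {x \<in> V \<times> {a..c}. b \<le> snd x} H3"
          by (rule continuous_on_subset[OF H3(1)]) (use Vsub in auto)
        show "continuous_on (V \<times> {a..c}) snd" by (rule continuous_on_snd[OF continuous_on_id])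
        show "H1 w = H3 w" if "w \<in> V \<times> {a..c}" "snd w = b" for w
          using that Veq[of "fst w"] by (cases w) auto
      qed
      moreover have "H ` (V \<times> {a..c}) \<subseteq> S"
      proof (rule image_subsetI)
        fix w assume "w \<in> V \<times> {a..c}"
        then have "if snd w \<le> b then w \<in> V1 \<times> {a..b} else w \<in> V2 \<times> {b..c}" using Vsub by auto
        then show "H w \<in> S" 
          unfolding H_def using subsetD[OF H1(2) imageI] subsetD[OF H3(2) imageI] by (simp split: if_splits)
      qed
      moreover have "\<forall>w\<in>V \<times> {a..c}. proj_point (H w) = h w"
      proof
        fix w assume "w \<in> V \<times> {a..c}"
        then have "if snd w \<le> b then w \<in> V1 \<times> {a..b} else w \<in> V2 \<times> {b..c}" using Vsub by auto
        then show "proj_point (H w) = h w" using H1(3) H3(3) unfolding H_def by (simp split: if_splits)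
      qed
      ultimately show "\<exists>V H. openin (top_of_set Z) V \<and> z0 \<in> V \<and> continuous_on (V \<times> {a..c}) H \<and>
           H ` (V \<times> {a..c}) \<subseteq> S \<and> (\<forall>w\<in>V \<times> {a..c}. proj_point (H w) = h w)"
        using V z0V by blast
    qed
  next
    case (local x)
    have "h (z0, x) \<in> topspace ?P"
      using h z0 local by (auto simp: continuous_map_def)
    then obtain c where c: "c \<in> S" "h (z0, x) = proj_point c"
      unfolding topspace_proj_product S_def by blast
    obtain i where i: "c 0 i \<noteq> 0"
      using c(1) \<open>0 < r\<close> unfolding S_def by (rule prod_spheres_set_nonzero_coordinate)
    define C where "C = proj_point ` {x \<in> S. x 0 i \<noteq> 0}"
    have C: "openin ?P C" using local_section(1)[OF \<open>0 < r\<close>] unfolding C_def S_def .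
    obtain \<sigma> where \<sigma>: "continuous_map (subtopology ?P C) (top_of_set S) \<sigma>" "\<And>A. A \<in> C \<Longrightarrow> proj_point (\<sigma> A) = A"
      using local_section(2)[OF \<open>0 < r\<close>] unfolding C_def S_def by meson
    have "openin (top_of_set (Z \<times> ?I)) {w \<in> topspace (top_of_set (Z \<times> ?I)). h w \<in> C}"
      by (rule openin_continuous_map_preimage[OF h C])
    then have "openin (prod_topology (top_of_set Z) (top_of_set ?I)) {w \<in> Z \<times> ?I. h w \<in> C}"
      by simp
    moreover have "(z0, x) \<in> {w \<in> Z \<times> ?I. h w \<in> C}"
      using z0 local c i by (auto simp: C_def)
    ultimately obtain V T where V: "openin (top_of_set Z) V" "z0 \<in> V"
      and T: "openin (top_of_set ?I) T" "x \<in> T" and VT: "V \<times> T \<subseteq> {w \<in> Z \<times> ?I. h w \<in> C}"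
      unfolding openin_prod_topology_alt by meson
    \<comment> \<open>This \<open>d\<close> is the interval length that Bolzano's principle asks
      for: an interval in [0,1] around \<open>x\<close> shorter than \<open>d\<close> stays in
      \<open>T\<close>, so \<open>h\<close> maps \<open>V\<close> times that interval into the
      domain of the section.\<close>
    obtain d where d: "d > 0" "ball x d \<inter> ?I \<subseteq> T"
      using T by (meson openin_contains_ball)
    have "Q a b" if ab: "a \<le> x" "x \<le> b" "b - a < d" for a b
      unfolding Q_def
    proof (intro impI)
      assume "0 \<le> a \<and> b \<le> 1"
      then have "{a..b} \<subseteq> T"
        using d(2) ab by (force simp: dist_real_def)
      then have sub: "V \<times> {a..b} \<subseteq> {w \<in> Z \<times> ?I. h w \<in> C}" using VT by auto
      have "continuous_map (subtopology (top_of_set (Z \<times> ?I)) (V \<times> {a..b})) (subtopology ?P C) h"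
        unfolding continuous_map_in_subtopology
        using h sub by (auto intro: continuous_map_from_subtopology)
      moreover have "subtopology (top_of_set (Z \<times> ?I)) (V \<times> {a..b}) = top_of_set (V \<times> {a..b})"
      proof -
        have "V \<times> {a..b} \<subseteq> Z \<times> ?I" using sub by blast
        then show ?thesis unfolding subtopology_subtopology by (simp only: Int_absorb1)
      qed
      ultimately have "continuous_map (top_of_set (V \<times> {a..b})) (top_of_set S) (\<sigma> \<circ> h)"
        using \<sigma>(1) continuous_map_compose by metis
      moreover have "\<forall>w\<in>V \<times> {a..b}. proj_point ((\<sigma> \<circ> h) w) = h w"
        using \<sigma>(2) sub by auto
      ultimately show "\<exists>V H. openin (top_of_set Z) V \<and> z0 \<in> V \<and> continuous_on (V \<times> {a..b}) H \<and>
           H ` (V \<times> {a..b}) \<subseteq> S \<and> (\<forall>w\<in>V \<times> {a..b}. proj_point (H w) = h w)"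
        using V by (intro exI[of _ V] exI[of _ "\<sigma> \<circ> h"]) auto
    qed
    then show ?case using d(1) by blast
  qed
  then show ?thesis unfolding Q_def by simp
qed

text \<open>Local lifts over cylinders are first corrected by a sign so as to start at
  \<open>f\<close>. On overlaps they then agree along each segment over a single point, by
  uniqueness of lifts, and can be pasted.\<close>

lemma homotopy_lift:
  fixes Z :: "'a::topological_space set" and h :: "'a \<times> real \<Rightarrow> _" and n r
  defines "S \<equiv> prod_spheres_set n r"
  assumes "0 < r"
    and h: "continuous_map (top_of_set (Z \<times> {0..1})) (proj_product n r) h"
    and f: "continuous_on Z f" "f ` Z \<subseteq> S" "\<And>z. z \<in> Z \<Longrightarrow> proj_point (f z) = h (z, 0)"
  obtains H where "continuous_on (Z \<times> {0..1}) H" "H ` (Z \<times> {0..1}) \<subseteq> S"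
    "\<And>w. w \<in> Z \<times> {0..1} \<Longrightarrow> proj_point (H w) = h w" "\<And>z. z \<in> Z \<Longrightarrow> H (z, 0) = f z"
proof -
  let ?I = "{0..1::real}"
  have "\<forall>z0\<in>Z. \<exists>V H. openin (top_of_set Z) V \<and> z0 \<in> V \<and> continuous_on (V \<times> ?I) H \<and>
           H ` (V \<times> ?I) \<subseteq> S \<and> (\<forall>w\<in>V \<times> ?I. proj_point (H w) = h w) \<and> (\<forall>z\<in>V. H (z, 0) = f z)"
  proof
    fix z0 assume z0: "z0 \<in> Z"
    obtain V1 H1 where V1: "openin (top_of_set Z) V1" "z0 \<in> V1"
      and H1: "continuous_on (V1 \<times> ?I) H1" "H1 ` (V1 \<times> ?I) \<subseteq> S"
        "\<And>w. w \<in> V1 \<times> ?I \<Longrightarrow> proj_point (H1 w) = h w"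
      using local_lift[OF \<open>0 < r\<close> h z0] unfolding S_def by blast
    have VZ: "V1 \<subseteq> Z" using V1 by (simp add: openin_imp_subset)
    define H where "H w = (if f (fst w) = H1 (fst w, 0) then H1 w else antipode (H1 w))" for w
    let ?d = "\<lambda>z. dot (n 0) (f z 0) (H1 (z, 0) 0)"
    have d: "?d z = (if f z = H1 (z, 0) then 1 else -1)" if "z \<in> V1" for z
      by (rule dot_proj_point_eq[where r=r])
        (use H1(3)[of "(z, 0)"] f(2,3) that VZ \<open>0 < r\<close> in \<open>auto simp: image_subset_iff S_def\<close>)
    \<comment> \<open>The correction by cases equals multiplication by the sheet detector, a form in
      which it is visibly continuous.\<close>
    have H_eq: "H w = (\<lambda>j i. ?d (fst w) * H1 w j i)" if "w \<in> V1 \<times> ?I" for w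
    proof -
      from that have "fst w \<in> V1" by auto
      from d[OF this] show ?thesis by (auto simp: H_def fun_eq_iff)
    qed
    have c1: "continuous_on (V1 \<times> ?I) (\<lambda>w. f (fst w))"
      by (rule continuous_on_compose2[OF f(1)]) (use VZ in \<open>auto intro!: continuous_intros\<close>)
    have c2: "continuous_on (V1 \<times> ?I) (\<lambda>w. H1 (fst w, 0))"
      by (rule continuous_on_compose2[OF H1(1)]) (auto intro!: continuous_intros)
    have "continuous_on (V1 \<times> ?I) (\<lambda>w j i. ?d (fst w) * H1 w j i)"
      by (rule continuous_on_coordinatewise_then_product, rule continuous_on_coordinatewise_then_product)
        (intro continuous_on_mult continuous_on_dot continuous_on_coordinate2 c1 c2 H1(1))
    then have "continuous_on (V1 \<times> ?I) H"
      by (subst continuous_on_cong[OF refl H_eq])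
    moreover have "H ` (V1 \<times> ?I) \<subseteq> S"
      using H1(2) unfolding H_def S_def by (auto simp: image_subset_iff)
    moreover have "\<forall>w\<in>V1 \<times> ?I. proj_point (H w) = h w"
      using H1(3) by (simp add: H_def)
    moreover have "\<forall>z\<in>V1. H (z, 0) = f z"
    proof
      fix z assume that: "z \<in> V1"
      have "proj_point (f z) = proj_point (H1 (z, 0))" using f(3) H1(3)[of "(z, 0)"] that VZ by auto
      then show "H (z, 0) = f z" unfolding proj_point_eq_iff H_def by auto
    qed
    ultimately show "\<exists>V H. openin (top_of_set Z) V \<and> z0 \<in> V \<and> continuous_on (V \<times> ?I) H \<and>
           H ` (V \<times> ?I) \<subseteq> S \<and> (\<forall>w\<in>V \<times> ?I. proj_point (H w) = h w) \<and> (\<forall>z\<in>V. H (z, 0) = f z)"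
      using V1 by (intro exI conjI)
  qed
  from bchoice[OF this] obtain V where "\<forall>z0\<in>Z. \<exists>H. openin (top_of_set Z) (V z0) \<and> z0 \<in> V z0 \<and>
      continuous_on (V z0 \<times> ?I) H \<and> H ` (V z0 \<times> ?I) \<subseteq> S \<and>
      (\<forall>w\<in>V z0 \<times> ?I. proj_point (H w) = h w) \<and> (\<forall>z\<in>V z0. H (z, 0) = f z)"
    by (elim exE)
  from bchoice[OF this] obtain L where VL: "\<forall>z0\<in>Z. openin (top_of_set Z) (V z0) \<and> z0 \<in> V z0 \<and>
      continuous_on (V z0 \<times> ?I) (L z0) \<and> L z0 ` (V z0 \<times> ?I) \<subseteq> S \<and>
      (\<forall>w\<in>V z0 \<times> ?I. proj_point (L z0 w) = h w) \<and> (\<forall>z\<in>V z0. L z0 (z, 0) = f z)"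
    by (elim exE)
  note VL' = VL[rule_format]
  note V = VL'[THEN conjunct1] VL'[THEN conjunct2, THEN conjunct1]
  note VL'' = VL'[THEN conjunct2, THEN conjunct2]
  note L = VL''[THEN conjunct1] VL''[THEN conjunct2, THEN conjunct1]
    VL''[THEN conjunct2, THEN conjunct2, THEN conjunct1, THEN bspec]
    VL''[THEN conjunct2, THEN conjunct2, THEN conjunct2, THEN bspec]
  have VZ: "V z \<subseteq> Z" if "z \<in> Z" for z using V(1)[OF that] by (rule openin_imp_subset)
  have sub: "subtopology (top_of_set (Z \<times> ?I)) (V z \<times> ?I) = top_of_set (V z \<times> ?I)" if "z \<in> Z" for z
    using VZ[OF that] by (simp add: subtopology_subtopology Times_Int_Times Int_absorb1)
  obtain H where H: "continuous_map (top_of_set (Z \<times> ?I)) (top_of_set S) H"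
    "\<And>w z. z \<in> Z \<Longrightarrow> w \<in> topspace (top_of_set (Z \<times> ?I)) \<inter> (V z \<times> ?I) \<Longrightarrow> H w = L z w"
  proof (rule pasting_lemma_exists[of "top_of_set (Z \<times> ?I)" "\<lambda>z. V z \<times> ?I" Z "top_of_set S" L])
    show "topspace (top_of_set (Z \<times> ?I)) \<subseteq> (\<Union>z\<in>Z. V z \<times> ?I)" using V(2) by auto
    show "openin (top_of_set (Z \<times> ?I)) (V z \<times> ?I)" if "z \<in> Z" for z
      using V(1)[OF that] by (simp add: openin_Times)
    show "continuous_map (subtopology (top_of_set (Z \<times> ?I)) (V z \<times> ?I)) (top_of_set S) (L z)" if "z \<in> Z" for z
      unfolding sub[OF that] using L(1,2)[OF that] by auto
    show "L a w = L b w" if ab: "a \<in> Z" "b \<in> Z" and w: "w \<in> topspace (top_of_set (Z \<times> ?I)) \<inter> V a \<times> ?I \<inter> V b \<times> ?I" for a b w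
    proof -
      obtain z t where zt: "w = (z, t)" "z \<in> V a" "z \<in> V b" "t \<in> ?I" using w by (cases w) auto
      have cont: "continuous_on ?I (\<lambda>t. L c (z, t))" if "c \<in> Z" "z \<in> V c" for c
        by (rule continuous_on_compose2[OF L(1)[OF that(1)]]) (use that in \<open>auto intro!: continuous_intros\<close>)
      have "L a (z, t) = L b (z, t)"
        by (rule lift_unique[OF \<open>0 < r\<close>, of ?I "\<lambda>t. L a (z, t)" n "\<lambda>t. L b (z, t)" 0 t])
          (use ab zt L(2)[OF ab(1)] L(3,4) cont in \<open>auto simp: S_def image_subset_iff\<close>)
      then show ?thesis using zt(1) by simp
    qed
  qed blast
  show thesis
  proof
    show "continuous_on (Z \<times> ?I) H" "H ` (Z \<times> ?I) \<subseteq> S" using H(1) by auto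
    show "proj_point (H w) = h w" if "w \<in> Z \<times> ?I" for w
      using that H(2)[of "fst w" w] L(3)[of "fst w" w] V(2)[of "fst w"] by auto
    show "H (z, 0) = f z" if "z \<in> Z" for z
      using that H(2)[of z "(z, 0)"] L(4)[of z z] V(2)[of z] by auto
  qed
qed

subsection \<open>Motion planners and topological complexity\<close>

text \<open>In the reduced convention \<open>card A\<close> sets give the bound
  \<open>card A - 1\<close>; nonemptiness of \<open>A\<close> keeps this subtraction from truncating
  and makes the inequality strict.\<close>

lemma TC_less_card:
  assumes "finite A" "A \<noteq> {}"
    and "\<And>a. a \<in> A \<Longrightarrow> openin (prod_topology X X) (U a) \<and> (\<exists>s. motion_planner X (U a) s)"
    and cover: "topspace (prod_topology X X) \<subseteq> (\<Union>a\<in>A. U a)"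
  shows "TC X < enat (card A)"
proof -
  obtain h where h: "bij_betw h {0..<card A} A"
    using ex_bij_betw_nat_finite[OF assms(1)] by blast
  have pos: "card A > 0" using assms(1,2) by (simp add: card_gt_0_iff)
  have eq: "{..card A - 1} = {0..<card A}" using pos by auto
  have hA: "h ` {..card A - 1} = A" using h eq by (simp add: bij_betw_def)
  have "\<forall>i\<le>card A - 1. openin (prod_topology X X) ((U \<circ> h) i) \<and> (\<exists>s. motion_planner X ((U \<circ> h) i) s)"
    using assms(3) hA by auto
  moreover have "topspace (prod_topology X X) \<subseteq> (\<Union>i\<le>card A - 1. (U \<circ> h) i)"
  proof -
    have "(\<Union>i\<le>card A - 1. (U \<circ> h) i) = (\<Union>a\<in>h ` {..card A - 1}. U a)" by auto
    then show ?thesis using cover unfolding hA by (simp only:)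
  qed
  ultimately have "TC X \<le> enat (card A - 1)"
    unfolding TC_def by (intro Inf_lower imageI CollectI exI conjI)
  also have "\<dots> < enat (card A)" using pos by simp
  finally show ?thesis .
qed

text \<open>An infimum of extended naturals is attained unless the set is empty, and then it would
  be infinite.\<close>

lemma TC_eq_enatE:
  assumes "TC X = enat t"
  obtains U where "\<And>i. i \<le> t \<Longrightarrow> openin (prod_topology X X) (U i)"
    "\<And>i. i \<le> t \<Longrightarrow> \<exists>s. motion_planner X (U i) s"
    "topspace (prod_topology X X) \<subseteq> (\<Union>i\<le>t. U i)"
proof -
  define K where "K = {k. \<exists>U :: nat \<Rightarrow> ('a \<times> 'a) set.
      (\<forall>i\<le>k. openin (prod_topology X X) (U i) \<and> (\<exists>s. motion_planner X (U i) s)) \<and>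
      topspace (prod_topology X X) \<subseteq> (\<Union>i\<le>k. U i)}"
  have TC: "TC X = Inf (enat ` K)" unfolding TC_def K_def ..
  have "enat ` K \<noteq> {}"
    using assms unfolding TC Inf_enat_def by (simp split: if_splits)
  then have "Inf (enat ` K) \<in> enat ` K"
    by (metis Inf_enat_def LeastI ex_in_conv)
  then have "t \<in> K" using assms unfolding TC by auto
  then obtain U :: "nat \<Rightarrow> ('a \<times> 'a) set" where
    "\<forall>i\<le>t. openin (prod_topology X X) (U i) \<and> (\<exists>s. motion_planner X (U i) s)"
    "topspace (prod_topology X X) \<subseteq> (\<Union>i\<le>t. U i)"
    unfolding K_def mem_Collect_eq by (elim exE conjE)
  then show thesis by (intro that[of U]) simp_all
qed

text \<open>These are the data that descend by \<open>motion_planner_from_lift\<close>. End points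
  and symmetry are required only after \<open>proj_point\<close>, since a lift may change by a
  global sign.\<close>

definition equivariant_planner where
  "equivariant_planner n r W G \<longleftrightarrow>
     openin (top_of_set (prod_spheres_set n r \<times> prod_spheres_set n r)) W \<and>
     (\<forall>x y. (x, y) \<in> W \<longrightarrow> (antipode x, y) \<in> W \<and> (x, antipode y) \<in> W) \<and>
     continuous_on (W \<times> {0..1::real}) G \<and> G ` (W \<times> {0..1}) \<subseteq> prod_spheres_set n r \<and>
     (\<forall>x y. (x, y) \<in> W \<longrightarrow> proj_point (G ((x, y), 0)) = proj_point x \<and> proj_point (G ((x, y), 1)) = proj_point y) \<and>
     (\<forall>x y t. (x, y) \<in> W \<longrightarrow> t \<in> {0..1} \<longrightarrow>
        proj_point (G ((antipode x, y), t)) = proj_point (G ((x, y), t)) \<and>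
        proj_point (G ((x, antipode y), t)) = proj_point (G ((x, y), t)))"

lemma TC_proj_product_less_card:
  assumes "finite A" "A \<noteq> {}"
    and W: "\<And>a. a \<in> A \<Longrightarrow> \<exists>G. equivariant_planner n r (W a) G"
    and cover: "prod_spheres_set n r \<times> prod_spheres_set n r \<subseteq> (\<Union>a\<in>A. W a)"
  shows "TC (proj_product n r) < enat (card A)"
proof (rule TC_less_card[OF assms(1,2), where U = "\<lambda>a. map_prod proj_point proj_point ` W a"])
  let ?P = "proj_product n r" and ?S = "prod_spheres_set n r"
  fix a assume "a \<in> A"
  then obtain G where G: "equivariant_planner n r (W a) G" using W by blast
  have "openin (prod_topology ?P ?P) (map_prod proj_point proj_point ` W a)"
    by (rule motion_planner_from_lift(1)[of n r "W a" G])
      (use G in \<open>simp_all add: equivariant_planner_def\<close>)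
  moreover have "\<exists>s. motion_planner ?P (map_prod proj_point proj_point ` W a) s"
    by (rule motion_planner_from_lift(2)[of n r "W a" G])
      (use G in \<open>simp_all add: equivariant_planner_def\<close>)
  ultimately show "openin (prod_topology ?P ?P) (map_prod proj_point proj_point ` W a) \<and>
      (\<exists>s. motion_planner ?P (map_prod proj_point proj_point ` W a) s)" ..
next
  have "topspace (prod_topology (proj_product n r) (proj_product n r)) =
      map_prod proj_point proj_point ` (prod_spheres_set n r \<times> prod_spheres_set n r)"
    by (simp add: topspace_proj_product map_prod_surj_on)
  also have "\<dots> \<subseteq> map_prod proj_point proj_point ` (\<Union>a\<in>A. W a)" by (intro image_mono cover)
  finally show "topspace (prod_topology (proj_product n r) (proj_product n r)) \<subseteq>
      (\<Union>a\<in>A. map_prod proj_point proj_point ` W a)"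
    by (simp add: image_UN)
qed

section \<open>Radial projection and finiteness of the topological complexity of projective
  space\<close>

definition normalized :: "nat \<Rightarrow> (nat \<Rightarrow> real) \<Rightarrow> nat \<Rightarrow> real" where
  "normalized m z = (\<lambda>i. z i / sqrt (dot m z z))"

lemma dot_self_pos: "(\<exists>i\<le>m. z i \<noteq> 0) \<Longrightarrow> dot m z z > 0"
  unfolding dot_def by (force intro: sum_pos2 simp: zero_less_mult_iff)

lemma normalized_in_sphere_set:
  assumes "\<exists>i\<le>m. z i \<noteq> 0" "\<And>i. i > m \<Longrightarrow> z i = 0"
  shows "normalized m z \<in> sphere_set m"
proof -
  have pos: "dot m z z > 0" using assms(1) by (rule dot_self_pos)
  have "(\<Sum>i\<le>m. (normalized m z i)\<^sup>2) = (\<Sum>i\<le>m. z i * z i / dot m z z)"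
    using pos by (intro sum.cong) (auto simp: normalized_def power_divide power2_eq_square)
  also have "\<dots> = dot m z z / dot m z z" by (simp only: dot_def sum_divide_distrib[symmetric])
  finally show ?thesis using pos assms(2) by (simp add: sphere_set_def normalized_def)
qed

text \<open>Only the sign of the scalar survives radial projection, and projective space forgets it;
  with scalar 1, points of the sphere are fixed. For \<open>c = 0\<close> both sides vanish, since
  division by 0 gives 0.\<close>

lemma normalized_scale:
  assumes "x \<in> sphere_set m"
  shows "normalized m (\<lambda>i. c * x i) = (\<lambda>i. sgn c * x i)"
proof -
  have "dot m (\<lambda>i. c * x i) (\<lambda>i. c * x i) = (\<Sum>i\<le>m. c\<^sup>2 * (x i)\<^sup>2)"
    unfolding dot_def by (intro sum.cong) (auto simp: power2_eq_square)
  also have "\<dots> = c\<^sup>2" using assms by (simp add: sphere_set_def flip: sum_distrib_left)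
  finally show ?thesis by (simp add: normalized_def sgn_if fun_eq_iff)
qed

lemma normalized_minus: "normalized m (\<lambda>i. - z i) = (\<lambda>i. - normalized m z i)"
  by (simp add: normalized_def dot_def)

lemma continuous_on_normalized:
  fixes f :: "'a::topological_space \<Rightarrow> nat \<Rightarrow> real"
  assumes f: "\<And>i. continuous_on A (\<lambda>x. f x i)" and nz: "\<And>x. x \<in> A \<Longrightarrow> \<exists>i\<le>m. f x i \<noteq> 0"
  shows "continuous_on A (\<lambda>x. normalized m (f x) i)"
  unfolding normalized_def
proof (intro continuous_on_divide f ballI)
  show "continuous_on A (\<lambda>x. sqrt (dot m (f x) (f x)))"
    unfolding dot_def by (intro continuous_on_real_sqrt continuous_on_sum continuous_on_mult f)
  show "sqrt (dot m (f x) (f x)) \<noteq> 0" if "x \<in> A" for x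
    using dot_self_pos[OF nz[OF that]] by simp
qed

text \<open>The two lines are joined through the line of \<open>e\<^sub>i + e\<^sub>j\<close>.\<close>

lemma real_proj_space_local_planner:
  fixes m i j :: nat
  defines "S \<equiv> prod_spheres_set (\<lambda>_. m) 1"
  assumes ij: "i \<le> m" "j \<le> m"
  defines "W \<equiv> {(x, y) \<in> S \<times> S. x 0 i \<noteq> 0 \<and> y 0 j \<noteq> 0}"
  shows "\<exists>G. equivariant_planner (\<lambda>_. m) 1 W G"
proof -
  define e :: "nat \<Rightarrow> real" where "e l = of_bool (l = i) + of_bool (l = j)" for l
  \<comment> \<open>The path is piecewise linear from \<open>x 0 i\<close> times \<open>x 0\<close>
    at time 0 through \<open>e\<close> at time 1/2 to \<open>y 0 j\<close> times \<open>y 0\<close>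
    at time 1. The scalar weights make it invariant under changing the sign of \<open>x\<close> or
    of \<open>y\<close>.\<close>
  define z where "z w l = (case w of ((x, y), t) \<Rightarrow>
      max 0 (1 - 2 * t) * (x 0 i * x 0 l) + max 0 (2 * t - 1) * (y 0 j * y 0 l) + (1 - \<bar>2 * t - 1\<bar>) * e l)"
    for w :: "((nat \<Rightarrow> nat \<Rightarrow> real) \<times> (nat \<Rightarrow> nat \<Rightarrow> real)) \<times> real" and l :: nat
  define G where "G w = (\<lambda>k::nat. if k = 0 then normalized m (z w) else (\<lambda>_. 0))" for w :: "((nat \<Rightarrow> nat \<Rightarrow> real) \<times> (nat \<Rightarrow> nat \<Rightarrow> real)) \<times> real"
  have S: "x \<in> S \<longleftrightarrow> x 0 \<in> sphere_set m \<and> (\<forall>k>0. x k = (\<lambda>_. 0))" for x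
    by (auto simp: S_def prod_spheres_set_def)
  have "continuous_on (S \<times> S) (\<lambda>w. fst w 0 i * snd w 0 j)"
    by (rule continuous_on_mult; rule continuous_on_coordinate2; intro continuous_intros)
  then have "openin (top_of_set (S \<times> S)) ((S \<times> S) \<inter> (\<lambda>w. fst w 0 i * snd w 0 j) -` (- {0}))"
    by (rule continuous_openin_preimage_gen) (simp add: open_Compl)
  moreover have "(S \<times> S) \<inter> (\<lambda>w. fst w 0 i * snd w 0 j) -` (- {0}) = W"
    by (auto simp: W_def)
  ultimately have op: "openin (top_of_set (S \<times> S)) W" by simp
  \<comment> \<open>In the first half coordinate \<open>i\<close> is positive, being a combination
    of the square of \<open>x 0 i\<close> and of \<open>e i\<close>; in the second half the same
    holds for coordinate \<open>j\<close>.\<close>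
  have nz: "\<exists>l\<le>m. z w l \<noteq> 0" if "w \<in> W \<times> {0..1}" for w
  proof -
    obtain x y t where w: "w = ((x, y), t)" by (metis surj_pair)
    have xy: "x 0 i * x 0 i > 0" "y 0 j * y 0 j > 0" "0 \<le> t" "t \<le> 1"
      using that unfolding w W_def by (auto simp: zero_less_mult_iff)
    have e: "e i \<ge> 1" "e j \<ge> 1" by (auto simp: e_def)
    show ?thesis
    proof (cases "2 * t \<le> 1")
      case True
      have "(1 - 2 * t) * (x 0 i * x 0 i) + 2 * t * e i > 0"
      proof (cases "2 * t = 1")
        case False
        then have "(1 - 2 * t) * (x 0 i * x 0 i) > 0" using True xy(1) by (intro mult_pos_pos[OF _ xy(1)]) simp
        moreover have "2 * t * e i \<ge> 0" using xy e by (intro mult_nonneg_nonneg) auto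
        ultimately show ?thesis by linarith
      qed (use e in simp)
      then have "z w i > 0" using True by (simp add: z_def w)
      then show ?thesis using ij by (intro exI[of _ i]) auto
    next
      case False
      have "(2 * t - 1) * (y 0 j * y 0 j) > 0" using False by (intro mult_pos_pos[OF _ xy(2)]) simp
      moreover have "(2 - 2 * t) * e j \<ge> 0" using xy e by (intro mult_nonneg_nonneg) auto
      moreover have "z w j = (2 * t - 1) * (y 0 j * y 0 j) + (2 - 2 * t) * e j"
        using False by (simp add: z_def w)
      ultimately have "z w j > 0" by linarith
      then show ?thesis using ij by (intro exI[of _ j]) auto
    qed
  qed
  have z0: "z w l = 0" if "w \<in> W \<times> {0..1}" "l > m" for w l
  proof -
    obtain x y t where w: "w = ((x, y), t)" by (metis surj_pair)
    have "x \<in> S" "y \<in> S" using that(1) unfolding w W_def by simp_all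
    then have "x 0 l = 0" "y 0 l = 0"
      using that(2) unfolding S sphere_set_def by simp_all
    moreover have "e l = 0" using that(2) ij by (simp add: e_def)
    ultimately show ?thesis by (simp add: z_def w)
  qed
  have GS: "G ` (W \<times> {0..1}) \<subseteq> S"
  proof (rule image_subsetI)
    fix w :: "((nat \<Rightarrow> nat \<Rightarrow> real) \<times> (nat \<Rightarrow> nat \<Rightarrow> real)) \<times> real"
    assume "w \<in> W \<times> {0..1}"
    from normalized_in_sphere_set[OF nz[OF this] z0[OF this]] show "G w \<in> S" by (simp add: S G_def)
  qed
  have zc: "continuous_on (W \<times> {0..1}) (\<lambda>w. z w l)" for l
  proof -
    have "continuous_on (W \<times> {0..1::real}) (\<lambda>w. fst (fst w) 0 k)"
      "continuous_on (W \<times> {0..1::real}) (\<lambda>w. snd (fst w) 0 k)" for k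
      by (rule continuous_on_coordinate2; intro continuous_intros)+
    then show ?thesis
      unfolding z_def case_prod_unfold by (intro continuous_intros)
  qed
  have Gc: "continuous_on (W \<times> {0..1}) G"
    unfolding G_def
  proof (rule continuous_on_coordinatewise_then_product, rule continuous_on_coordinatewise_then_product)
    show "continuous_on (W \<times> {0..1}) (\<lambda>w. (if k = 0 then normalized m (z w) else (\<lambda>_. 0)) l)" for k l
      using continuous_on_normalized[OF zc nz] by (cases "k = 0") simp_all
  qed
  have sg: "proj_point (\<lambda>k. if k = 0 then (\<lambda>l. sgn c * x 0 l) else (\<lambda>_. 0)) = proj_point x" if "x \<in> S" "c \<noteq> 0" for x c
  proof -
    have "(\<lambda>k. if k = 0 then (\<lambda>l. x 0 l) else (\<lambda>_. 0)) = x"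
      using that(1) unfolding S by (intro ext) simp
    moreover have "(\<lambda>k. if k = 0 then (\<lambda>l. - x 0 l) else (\<lambda>_. 0)) = antipode x"
      using that(1) unfolding S antipode_def by (intro ext) simp
    ultimately show ?thesis
      using that(2) unfolding proj_point_eq_iff by (cases "c > 0") (simp_all cong: if_cong)
  qed
  have "proj_point (G ((x, y), 0)) = proj_point x \<and> proj_point (G ((x, y), 1)) = proj_point y" if "(x, y) \<in> W" for x y
  proof -
    have xy: "x \<in> S" "y \<in> S" "x 0 i \<noteq> 0" "y 0 j \<noteq> 0" using that by (auto simp: W_def)
    have "z ((x, y), 0) = (\<lambda>l. x 0 i * x 0 l)" "z ((x, y), 1) = (\<lambda>l. y 0 j * y 0 l)"
      by (auto simp: z_def)
    then show ?thesis
      using xy unfolding G_def by (simp add: normalized_scale S[THEN iffD1, THEN conjunct1] sg cong: if_cong)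
  qed
  moreover have "G ((antipode x, y), t) = G ((x, y), t) \<and> G ((x, antipode y), t) = G ((x, y), t)" for x y t
  proof -
    have z_antipode: "z ((antipode x, y), t) = z ((x, y), t)" "z ((x, antipode y), t) = z ((x, y), t)"
      by (simp_all add: z_def fun_eq_iff)
    show ?thesis unfolding G_def z_antipode by simp
  qed
  moreover have "(antipode x, y) \<in> W \<and> (x, antipode y) \<in> W" if "(x, y) \<in> W" for x y
    using that by (auto simp: W_def S_def)
  ultimately show ?thesis
    using op Gc GS unfolding equivariant_planner_def S_def by (intro exI[of _ G]) simp
qed

text \<open>Pairs of affine charts form a finite cover with planners. Finiteness is needed to have
  an actual cover of the pairs of points of projective space to start from.\<close>

lemma TC_real_proj_space_finite: "TC (real_proj_space m) \<noteq> \<infinity>"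
proof -
  let ?S = "prod_spheres_set (\<lambda>_. m) 1"
  have "TC (proj_product (\<lambda>_. m) 1) < enat (card ({..m} \<times> {..m}))"
  proof (rule TC_proj_product_less_card[where
        W = "\<lambda>(i, j). {(x, y) \<in> ?S \<times> ?S. x 0 i \<noteq> 0 \<and> y 0 j \<noteq> 0}"])
    show "\<exists>G. equivariant_planner (\<lambda>_. m) 1 (case a of (i, j) \<Rightarrow>
        {(x, y) \<in> ?S \<times> ?S. x 0 i \<noteq> 0 \<and> y 0 j \<noteq> 0}) G" if "a \<in> {..m} \<times> {..m}" for a
      using that real_proj_space_local_planner by (cases a) auto
    show "?S \<times> ?S \<subseteq> (\<Union>a\<in>{..m} \<times> {..m}. case a of (i, j) \<Rightarrow>
        {(x, y) \<in> ?S \<times> ?S. x 0 i \<noteq> 0 \<and> y 0 j \<noteq> 0})"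
    proof clarify
      fix x y assume xy: "x \<in> ?S" "y \<in> ?S"
      obtain i where "i \<le> m" "x 0 i \<noteq> 0" 
        using prod_spheres_set_nonzero_coordinate[OF xy(1), of 0] by auto
      moreover obtain j where "j \<le> m" "y 0 j \<noteq> 0"
        using prod_spheres_set_nonzero_coordinate[OF xy(2), of 0] by auto
      ultimately show "(x, y) \<in> (\<Union>a\<in>{..m} \<times> {..m}. case a of (i, j) \<Rightarrow>
          {(x, y) \<in> ?S \<times> ?S. x 0 i \<noteq> 0 \<and> y 0 j \<noteq> 0})"
        using xy by (intro UN_I[of "(i, j)"]) auto
    qed
  qed auto
  then show ?thesis
    unfolding real_proj_space_def by (rule less_le_trans[THEN less_imp_neq]) simp
qed

subsection \<open>Paths between points of a sphere\<close>

text \<open>The pieces are open and pairwise disjoint, so the planners paste with no compatibility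
  to check.\<close>

lemma equivariant_planner_UN:
  assumes pl: "\<And>D. D \<in> \<D> \<Longrightarrow> equivariant_planner n r (V D) (G D)"
    and disj: "\<And>D D'. D \<in> \<D> \<Longrightarrow> D' \<in> \<D> \<Longrightarrow> D \<noteq> D' \<Longrightarrow> V D \<inter> V D' = {}"
  shows "\<exists>G. equivariant_planner n r (\<Union>D\<in>\<D>. V D) G"
proof -
  let ?S = "prod_spheres_set n r" and ?I = "{0..1::real}"
  let ?W = "\<Union>D\<in>\<D>. V D"
  have op: "openin (top_of_set (?S \<times> ?S)) (V D)" if "D \<in> \<D>" for D
    using pl[OF that] unfolding equivariant_planner_def by (elim conjE)
  have opW: "openin (top_of_set (?S \<times> ?S)) ?W"
    using op by (intro openin_Union) auto
  have opV: "openin (top_of_set ?W) (V D)" if "D \<in> \<D>" for D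
    by (rule openin_subset_trans[OF op[OF that] _ openin_imp_subset[OF opW]]) (use that in blast)
  have sub: "subtopology (top_of_set (?W \<times> ?I)) (V D \<times> ?I) = top_of_set (V D \<times> ?I)" if "D \<in> \<D>" for D
  proof -
    have "V D \<times> ?I \<subseteq> ?W \<times> ?I" using that by blast
    then show ?thesis unfolding subtopology_subtopology by (simp only: Int_absorb1)
  qed
  obtain F where F: "continuous_map (top_of_set (?W \<times> ?I)) (top_of_set ?S) F"
    and FG: "\<And>w D. D \<in> \<D> \<Longrightarrow> w \<in> topspace (top_of_set (?W \<times> ?I)) \<inter> V D \<times> ?I \<Longrightarrow> F w = G D w"
  proof (rule pasting_lemma_exists[of "top_of_set (?W \<times> ?I)" "\<lambda>D. V D \<times> ?I" \<D> "top_of_set ?S" G])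
    show "topspace (top_of_set (?W \<times> ?I)) \<subseteq> (\<Union>D\<in>\<D>. V D \<times> ?I)" by auto
    show "openin (top_of_set (?W \<times> ?I)) (V D \<times> ?I)" if "D \<in> \<D>" for D
      using opV[OF that] by (rule openin_Times) simp
    show "continuous_map (subtopology (top_of_set (?W \<times> ?I)) (V D \<times> ?I)) (top_of_set ?S) (G D)" if "D \<in> \<D>" for D
      unfolding sub[OF that] using pl[OF that] unfolding equivariant_planner_def by auto
    show "G D w = G D' w" if "D \<in> \<D>" "D' \<in> \<D>"
      "w \<in> topspace (top_of_set (?W \<times> ?I)) \<inter> V D \<times> ?I \<inter> V D' \<times> ?I" for D D' w
      using disj[OF that(1,2)] that(3) by (cases "D = D'") auto
  qed blast
  have FG': "F (z, t) = G D (z, t)" if "D \<in> \<D>" "z \<in> V D" "t \<in> ?I" for D z t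
    by (rule FG[OF that(1)]) (use that in auto)
  have inv: "(antipode x, y) \<in> V D \<and> (x, antipode y) \<in> V D" if "D \<in> \<D>" "(x, y) \<in> V D" for D x y
    using pl[OF that(1)] that(2) unfolding equivariant_planner_def by (elim conjE) simp
  show ?thesis
    unfolding equivariant_planner_def
  proof (intro exI[of _ F] conjI allI impI)
    show "openin (top_of_set (?S \<times> ?S)) ?W" by (rule opW)
    show "continuous_on (?W \<times> ?I) F" "F ` (?W \<times> ?I) \<subseteq> ?S" using F by auto
  next
    fix x y assume "(x, y) \<in> ?W"
    then obtain D where D: "D \<in> \<D>" "(x, y) \<in> V D" by blast
    show "(antipode x, y) \<in> ?W" "(x, antipode y) \<in> ?W"
      using inv[OF D] D(1) by blast+
    have "proj_point (G D ((x, y), 0)) = proj_point x \<and> proj_point (G D ((x, y), 1)) = proj_point y"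
      using pl[OF D(1)] D(2) unfolding equivariant_planner_def by (elim conjE) simp
    then show "proj_point (F ((x, y), 0)) = proj_point x" "proj_point (F ((x, y), 1)) = proj_point y"
      using FG'[OF D, of 0] FG'[OF D, of 1] by simp_all
    fix t assume t: "t \<in> ?I"
    have "proj_point (G D ((antipode x, y), t)) = proj_point (G D ((x, y), t)) \<and>
        proj_point (G D ((x, antipode y), t)) = proj_point (G D ((x, y), t))"
      using pl[OF D(1)] D(2) t unfolding equivariant_planner_def by (elim conjE) simp
    then show "proj_point (F ((antipode x, y), t)) = proj_point (F ((x, y), t))"
      "proj_point (F ((x, antipode y), t)) = proj_point (F ((x, y), t))"
      using FG'[OF D t] FG'[OF D(1) _ t] inv[OF D] by simp_all
  qed
qed

text \<open>A quarter turn in each coordinate plane (2k, 2k+1). For even \<open>m\<close> the last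
  coordinate has no partner and receives \<open>- v (m + 1)\<close>, which is 0 on the sphere; this
  creates the zeros at the two poles.\<close>

definition skew :: "nat \<Rightarrow> (nat \<Rightarrow> real) \<Rightarrow> nat \<Rightarrow> real" where
  "skew m v i = (if i > m then 0 else if even i then - v (i + 1) else v (i - 1))"

definition line_path :: "real \<Rightarrow> (nat \<Rightarrow> real) \<Rightarrow> (nat \<Rightarrow> real) \<Rightarrow> nat \<Rightarrow> real" where
  "line_path t u v i = (1 - t) * u i + t * v i"

text \<open>A piecewise linear path through \<open>u\<close>, \<open>- v\<close>, \<open>w\<close>
  and \<open>v\<close> at the times 0, 1/2, 3/4 and 1. The maxima encode the pieces in one formula
  that is continuous at sight.\<close>

definition detour_path :: "real \<Rightarrow> (nat \<Rightarrow> real) \<Rightarrow> (nat \<Rightarrow> real) \<Rightarrow> (nat \<Rightarrow> real) \<Rightarrow> nat \<Rightarrow> real" where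
  "detour_path t u v w i =
     max 0 (1 - 2 * t) * u i + max (- 2 * t) (4 * t - 3) * v i + max 0 (1 - \<bar>4 * t - 3\<bar>) * w i"

lemma sphere_set_dot_self: "v \<in> sphere_set m \<Longrightarrow> dot m v v = 1"
  by (simp add: sphere_set_def dot_def power2_eq_square)

lemma dot_lincomb: "dot m (\<lambda>i. a * u i + b * v i) w = a * dot m u w + b * dot m v w"
  by (simp add: dot_def distrib_right sum.distrib sum_distrib_left mult.assoc)

lemma dot_zero: "(\<And>i. i \<le> m \<Longrightarrow> z i = 0) \<Longrightarrow> dot m z w = 0"
  by (simp add: dot_def)

lemma dot_commute: "dot m u v = dot m v u"
  by (simp add: dot_def mult.commute)

text \<open>If the combination vanished, its inner products with \<open>u\<close> and with
  \<open>v\<close> would add up to \<open>1 + dot m u v = 0\<close>.\<close>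

lemma line_path_nonzero:
  assumes "u \<in> sphere_set m" "v \<in> sphere_set m" "- dot m u v < 1"
  shows "\<exists>i\<le>m. line_path t u v i \<noteq> 0"
proof (rule ccontr)
  assume "\<not> ?thesis"
  then have 0: "dot m (\<lambda>i. (1 - t) * u i + t * v i) w = 0" for w
    by (intro dot_zero) (simp add: line_path_def)
  have "(1 - t) + t * dot m u v = 0" "(1 - t) * dot m u v + t = 0"
    using 0[of u] 0[of v] assms(1,2) unfolding dot_lincomb
    by (simp_all add: sphere_set_dot_self dot_commute[of m v u])
  then have "1 + dot m u v = 0" by algebra
  then show False using assms(3) by linarith
qed

text \<open>Up to time 1/2 the inner product with \<open>v\<close> is negative, because
  \<open>u\<close> lies on the side of \<open>- v\<close>. Afterwards the assumption on
  \<open>w\<close> kills the coefficient of \<open>w\<close>, which leaves only time 1, where the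
  path is at \<open>v\<close>.\<close>

lemma detour_path_nonzero:
  assumes u: "u \<in> sphere_set m" and v: "v \<in> sphere_set m" "dot m u v < 0" and t: "0 \<le> t" "t \<le> 1"
    and w: "\<And>b c. (\<And>i. i \<le> m \<Longrightarrow> b * v i + c * w i = 0) \<Longrightarrow> c = 0"
  shows "\<exists>i\<le>m. detour_path t u v w i \<noteq> 0"
proof (rule ccontr)
  assume "\<not> ?thesis"
  then have 0: "detour_path t u v w i = 0" if "i \<le> m" for i using that by blast
  show False
  proof (cases "2 * t \<le> 1")
    case True
    then have "max 0 (1 - 2 * t) = 1 - 2 * t" "max (- 2 * t) (4 * t - 3) = - 2 * t"
      "max 0 (1 - \<bar>4 * t - 3\<bar>) = 0"
      using t by linarith+
    then have "detour_path t u v w = (\<lambda>i. (1 - 2 * t) * u i + (- 2 * t) * v i)"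
      by (intro ext) (simp add: detour_path_def)
    then have "dot m (\<lambda>i. (1 - 2 * t) * u i + (- 2 * t) * v i) v = 0"
      using 0 by (metis dot_zero)
    then have eq: "(1 - 2 * t) * dot m u v - 2 * t = 0"
      unfolding dot_lincomb using v(1) by (simp add: sphere_set_dot_self)
    have "(1 - 2 * t) * dot m u v \<le> 0"
      using True v(2) by (intro mult_nonneg_nonpos) auto
    then have "t = 0" using eq t by linarith
    then show False using eq v(2) by simp
  next
    case False
    then have "max 0 (1 - 2 * t) = 0" "max (- 2 * t) (4 * t - 3) = 4 * t - 3"
      "max 0 (1 - \<bar>4 * t - 3\<bar>) = 1 - \<bar>4 * t - 3\<bar>"
      using t by linarith+
    then have path: "detour_path t u v w = (\<lambda>i. (4 * t - 3) * v i + (1 - \<bar>4 * t - 3\<bar>) * w i)"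
      by (intro ext) (simp add: detour_path_def)
    have "1 - \<bar>4 * t - 3\<bar> = 0"
      by (rule w[of "4 * t - 3"]) (use 0 in \<open>simp add: path\<close>)
    then have "t = 1" using False by linarith
    then have "v i = 0" if "i \<le> m" for i using 0[OF that] unfolding path by simp
    then show False using sphere_set_dot_self[OF v(1)] dot_zero[of m v v] by simp
  qed
qed

text \<open>In a coordinate plane the relation is a linear system of determinant
  \<open>b\<^sup>2 + c\<^sup>2\<close>, so \<open>c \<noteq> 0\<close> kills every paired coordinate
  of \<open>v\<close>. For odd \<open>m\<close> nothing remains; for even \<open>m\<close> the last
  coordinate would have square 1.\<close>

lemma skew_independent:
  assumes v: "v \<in> sphere_set m" and m: "odd m \<or> (v m)\<^sup>2 < 1"
    and eq: "\<And>i. i \<le> m \<Longrightarrow> b * v i + c * skew m v i = 0"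
  shows "c = 0"
proof (rule ccontr)
  assume c: "c \<noteq> 0"
  have pair: "v i = 0 \<and> v (i + 1) = 0" if "even i" "i + 1 \<le> m" for i
  proof -
    have "b * v i - c * v (i + 1) = 0" "b * v (i + 1) + c * v i = 0"
      using eq[of i] eq[of "i + 1"] that by (simp_all add: skew_def)
    then have "(b\<^sup>2 + c\<^sup>2) * v i = 0" "(b\<^sup>2 + c\<^sup>2) * v (i + 1) = 0" by algebra+
    moreover have "b\<^sup>2 + c\<^sup>2 \<noteq> 0" using c by (metis sum_power2_eq_zero_iff)
    ultimately show ?thesis by (metis mult_eq_0_iff)
  qed
  have below: "v i = 0" if "i < m" for i
  proof (cases "even i")
    case False
    then obtain k where "i = 2 * k + 1" by (rule oddE)
    then show ?thesis using pair[of "2 * k"] that by simp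
  qed (use pair[of i] that in simp)
  have "(\<Sum>i\<le>m. (v i)\<^sup>2) = (\<Sum>i\<in>{m}. (v i)\<^sup>2)"
    using below by (intro sum.mono_neutral_right) auto
  then have vm: "(v m)\<^sup>2 = 1" using v by (simp add: sphere_set_def)
  then have "odd m" using m by simp
  then obtain k where "m = 2 * k + 1" by (rule oddE)
  then have "v m = 0" using pair[of "2 * k"] by simp
  then show False using vm by simp
qed

text \<open>Near a pole the direction of coordinate 0 is transversal to \<open>v\<close>: coordinate
  \<open>m\<close>, distinct from 0, gives \<open>b = 0\<close>, and then coordinate 0 gives
  \<open>c = 0\<close>. The factor \<open>v m\<close> makes the direction odd in
  \<open>v\<close>.\<close>

lemma pole_independent:
  fixes m :: nat
  assumes "v m \<noteq> 0" "m \<ge> 1"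
    and eq: "\<And>i. i \<le> m \<Longrightarrow> b * v i + c * (if i = 0 then v m else 0) = (0::real)"
  shows "c = 0"
proof -
  have "b = 0" using eq[of m, OF order_refl] assms(1,2) by simp
  then show ?thesis using eq[of 0, OF le0] \<open>b = 0\<close> assms(1) by simp
qed

subsection \<open>Lifting motion planners of real projective space\<close>

text \<open>\<open>K\<close> is the sphere component of the lift of a motion planner on real projective space;
  the lifted path from \<open>x\<^sub>0\<close> ends at \<open>e (x, y) y\<^sub>0\<close>.\<close>

definition lifted_planner where
  "lifted_planner n r Z K e \<longleftrightarrow>
     openin (top_of_set (prod_spheres_set n r \<times> prod_spheres_set n r)) Z \<and>
     (\<forall>x y. (x, y) \<in> Z \<longrightarrow> (antipode x, y) \<in> Z \<and> (x, antipode y) \<in> Z) \<and>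
     (\<forall>i. continuous_on (Z \<times> {0..1::real}) (\<lambda>w. K w i)) \<and>
     K ` (Z \<times> {0..1}) \<subseteq> sphere_set (n 0) \<and>
     continuous_on Z e \<and> e ` Z \<subseteq> {1, -1::real} \<and>
     (\<forall>x y. (x, y) \<in> Z \<longrightarrow> K ((x, y), 0) = x 0 \<and> K ((x, y), 1) = (\<lambda>i. e (x, y) * y 0 i) \<and>
        e (antipode x, y) = - e (x, y) \<and> e (x, antipode y) = - e (x, y)) \<and>
     (\<forall>x y t. (x, y) \<in> Z \<longrightarrow> t \<in> {0..1} \<longrightarrow>
        K ((antipode x, y), t) = (\<lambda>i. - K ((x, y), t) i) \<and>
        K ((x, antipode y), t) = K ((x, y), t))"

definition first_factor :: "(nat \<Rightarrow> nat \<Rightarrow> real) \<Rightarrow> nat \<Rightarrow> nat \<Rightarrow> real" where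
  "first_factor x = (\<lambda>j. if j = 0 then x 0 else (\<lambda>_. 0))"

lemma first_factor_in:
  "x \<in> prod_spheres_set n r \<Longrightarrow> 0 < r \<Longrightarrow> first_factor x \<in> prod_spheres_set (\<lambda>_. n 0) 1"
  by (simp add: prod_spheres_set_def first_factor_def)

lemma first_factor_antipode: "first_factor (antipode x) = antipode (first_factor x)"
  by (simp add: first_factor_def antipode_def fun_eq_iff)

lemma continuous_on_first_factor:
  assumes "continuous_on A f" shows "continuous_on A (\<lambda>x. first_factor (f x))"
  unfolding first_factor_def
proof (rule continuous_on_coordinatewise_then_product, rule continuous_on_coordinatewise_then_product)
  show "continuous_on A (\<lambda>x. (if j = 0 then f x 0 else (\<lambda>_. 0)) i)" for j :: nat and i
    using continuous_on_coordinate2[OF assms] by (cases "j = 0") simp_all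
qed

text \<open>The planner is pulled back to the spheres and lifted with start \<open>x 0\<close>.
  Uniqueness of lifts gives the symmetry: a sign change of \<open>x\<close> negates the whole path,
  while one of \<open>y\<close> leaves it alone, so that the sign relating its end to
  \<open>y 0\<close> flips in both cases.\<close>

lemma lifted_planner_exists:
  fixes n r
  defines "P \<equiv> real_proj_space (n 0)" and "S \<equiv> prod_spheres_set n r"
  assumes "0 < r" and U: "openin (prod_topology P P) U" and s: "motion_planner P U s"
  defines "Z \<equiv> {(x, y) \<in> S \<times> S. (proj_point (first_factor x), proj_point (first_factor y)) \<in> U}"
  shows "\<exists>K e. lifted_planner n r Z K e"
proof -
  let ?I = "{0..1::real}" and ?S0 = "prod_spheres_set (\<lambda>_. n 0) 1"
  let ?p = "\<lambda>x. proj_point (first_factor x)"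
  have P: "P = proj_product (\<lambda>_. n 0) 1" by (simp add: P_def real_proj_space_def)
  have ff: "continuous_map (top_of_set S) (top_of_set ?S0) first_factor"
    using continuous_on_first_factor[OF continuous_on_id] first_factor_in[OF _ \<open>0 < r\<close>]
    unfolding S_def by auto
  have cp: "continuous_map (top_of_set S) P ?p"
    using continuous_map_compose[OF ff continuous_map_proj_point] by (simp add: P o_def)
  have cpp: "continuous_map (top_of_set (S \<times> S)) (prod_topology P P) (map_prod ?p ?p)"
    using continuous_map_map_prod[OF cp cp] by simp
  have Z_eq: "Z = {z \<in> topspace (top_of_set (S \<times> S)). map_prod ?p ?p z \<in> U}"
    by (auto simp: Z_def)
  have Zop: "openin (top_of_set (S \<times> S)) Z"
    unfolding Z_eq by (rule openin_continuous_map_preimage[OF cpp U])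
  have ZS: "x \<in> S" "y \<in> S" "(?p x, ?p y) \<in> U" if "(x, y) \<in> Z" for x y
    using that by (auto simp: Z_def)
  have Zinv: "(antipode x, y) \<in> Z" "(x, antipode y) \<in> Z" if "(x, y) \<in> Z" for x y
    using ZS[OF that] by (simp_all add: Z_def S_def first_factor_antipode)
  have sub: "subtopology (top_of_set (S \<times> S)) Z = top_of_set Z"
    unfolding subtopology_subtopology using openin_imp_subset[OF Zop] by (simp only: Int_absorb1)
  have "continuous_map (subtopology (top_of_set (S \<times> S)) Z) (subtopology (prod_topology P P) U) (map_prod ?p ?p)"
    unfolding continuous_map_in_subtopology
    by (rule conjI[OF continuous_map_from_subtopology[OF cpp]]) (auto simp: Z_def)
  then have cZ: "continuous_map (top_of_set Z) (subtopology (prod_topology P P) U) (map_prod ?p ?p)"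
    unfolding sub .
  define h where "h = s \<circ> map_prod (map_prod ?p ?p) id"
  have "continuous_map (prod_topology (top_of_set Z) (top_of_set ?I)) P h"
    unfolding h_def
    by (rule continuous_map_compose[OF continuous_map_map_prod[OF cZ continuous_map_id]])
      (use s in \<open>simp add: motion_planner_def\<close>)
  then have h: "continuous_map (top_of_set (Z \<times> ?I)) (proj_product (\<lambda>_. n 0) 1) h"
    by (simp add: P)
  have h_antipode: "h ((antipode x, y), t) = h ((x, y), t)" "h ((x, antipode y), t) = h ((x, y), t)" for x y t
    by (simp_all add: h_def first_factor_antipode)
  have h01: "h ((x, y), 0) = ?p x" "h ((x, y), 1) = ?p y" if "(x, y) \<in> Z" for x y
    using s ZS(3)[OF that] by (simp_all add: h_def motion_planner_def)
  have fZ: "continuous_on Z (\<lambda>z. first_factor (fst z))"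
    by (intro continuous_on_first_factor continuous_on_fst continuous_on_id)
  obtain H where Hc: "continuous_on (Z \<times> ?I) H" and HS: "H ` (Z \<times> ?I) \<subseteq> ?S0"
    and Hh: "\<And>w. w \<in> Z \<times> ?I \<Longrightarrow> proj_point (H w) = h w"
    and H0: "\<And>z. z \<in> Z \<Longrightarrow> H (z, 0) = first_factor (fst z)"
  proof (rule homotopy_lift[OF zero_less_one h fZ])
    show "(\<lambda>z. first_factor (fst z)) ` Z \<subseteq> ?S0"
      using first_factor_in[OF _ \<open>0 < r\<close>] by (auto simp: Z_def S_def)
    show "proj_point (first_factor (fst z)) = h (z, 0)" if "z \<in> Z" for z
      using h01(1)[of "fst z" "snd z"] that by simp
  qed blast
  have HS': "H (z, t) \<in> ?S0" if "z \<in> Z" "t \<in> ?I" for z t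
    using subsetD[OF HS imageI, of "(z, t)"] that by simp
  have Hh': "proj_point (H (z, t)) = h (z, t)" if "z \<in> Z" "t \<in> ?I" for z t
    using Hh[of "(z, t)"] that by simp
  have Hpath: "continuous_on ?I (\<lambda>t. H (z, t))" if "z \<in> Z" for z
    by (rule continuous_on_compose2[OF Hc]) (use that in \<open>auto intro!: continuous_intros\<close>)
  have Hx: "H ((antipode x, y), t) = antipode (H ((x, y), t))" if "(x, y) \<in> Z" "t \<in> ?I" for x y t
  proof (rule lift_unique[OF zero_less_one connected_Icc, of 0 1 "\<lambda>t. H ((antipode x, y), t)" "\<lambda>_. n 0" "\<lambda>t. antipode (H ((x, y), t))" 0 t])
    show "continuous_on ?I (\<lambda>t. antipode (H ((x, y), t)))"
      by (rule continuous_on_compose2[OF continuous_on_antipode[of UNIV] Hpath[OF that(1)]]) simp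
  qed (use that Hpath Zinv HS' Hh' H0 in \<open>auto simp: h_antipode first_factor_antipode\<close>)
  have Hy: "H ((x, antipode y), t) = H ((x, y), t)" if "(x, y) \<in> Z" "t \<in> ?I" for x y t
    by (rule lift_unique[OF zero_less_one connected_Icc, of 0 1 "\<lambda>t. H ((x, antipode y), t)" "\<lambda>_. n 0" "\<lambda>t. H ((x, y), t)" 0 t])
      (use that Hpath Zinv HS' Hh' H0 in \<open>auto simp: h_antipode\<close>)
  \<comment> \<open>The end of the lift is \<open>y 0\<close> or its negative; the inner product
    reads off which, and is continuous.\<close>
  define e where "e z = dot (n 0) (H (z, 1) 0) (first_factor (snd z) 0)" for z
  have H1: "H ((x, y), 1) = first_factor y \<or> H ((x, y), 1) = antipode (first_factor y)"
    if "(x, y) \<in> Z" for x y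
    using Hh'[OF that, of 1] h01(2)[OF that] unfolding proj_point_eq_iff[symmetric] by simp
  have e: "e (x, y) = (if H ((x, y), 1) = first_factor y then 1 else -1)" if "(x, y) \<in> Z" for x y
    unfolding e_def snd_conv
    by (rule dot_proj_point_eq[where n = "\<lambda>_. n 0" and r = 1])
      (use HS'[OF that, of 1] Hh'[OF that, of 1] h01(2)[OF that] in simp_all)
  have e1: "H ((x, y), 1) 0 = (\<lambda>i. e (x, y) * y 0 i)" if "(x, y) \<in> Z" for x y
    using H1[OF that] e[OF that] by (auto simp: first_factor_def fun_eq_iff)
  have ec: "continuous_on Z e"
  proof -
    have "continuous_on Z (\<lambda>z. H (z, 1))"
      by (rule continuous_on_compose2[OF Hc]) (auto intro!: continuous_intros)
    then show ?thesis
      unfolding e_def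
      by (intro continuous_on_dot continuous_on_first_factor continuous_on_snd continuous_on_id)
  qed
  have "lifted_planner n r Z (\<lambda>w. H w 0) e"
    unfolding lifted_planner_def
  proof (intro conjI allI impI)
    show "openin (top_of_set (prod_spheres_set n r \<times> prod_spheres_set n r)) Z"
      using Zop by (simp add: S_def)
    show "continuous_on (Z \<times> ?I) (\<lambda>w. H w 0 i)" for i by (rule continuous_on_coordinate2[OF Hc])
    show "(\<lambda>w. H w 0) ` (Z \<times> ?I) \<subseteq> sphere_set (n 0)"
      using HS unfolding prod_spheres_set_def by (simp add: image_subset_iff)
    show "continuous_on Z e" by (rule ec)
    show "e ` Z \<subseteq> {1, -1}" using e by (auto split: if_splits)
  next
    fix x y assume xy: "(x, y) \<in> Z"
    show "(antipode x, y) \<in> Z" "(x, antipode y) \<in> Z" using Zinv[OF xy] .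
    show "H ((x, y), 0) 0 = x 0" using H0[OF xy] by (simp add: first_factor_def)
    show "H ((x, y), 1) 0 = (\<lambda>i. e (x, y) * y 0 i)" by (rule e1[OF xy])
    show "e (antipode x, y) = - e (x, y)" "e (x, antipode y) = - e (x, y)"
      using Hx[OF xy, of 1] Hy[OF xy, of 1] by (simp_all add: e_def dot_antipode first_factor_antipode)
    fix t assume "t \<in> ?I"
    then show "H ((antipode x, y), t) 0 = (\<lambda>i. - H ((x, y), t) 0 i)"
      "H ((x, antipode y), t) 0 = H ((x, y), t) 0"
      using Hx[OF xy] Hy[OF xy] by (simp_all add: fun_eq_iff)
  qed
  then show ?thesis by blast
qed

subsection \<open>Stratification by defects\<close>

text \<open>The representative of the second end point singled out by the lift. It is negated
  together with \<open>x\<close> and does not depend on the sign of \<open>y\<close>.\<close>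

definition aligned :: "((nat \<Rightarrow> nat \<Rightarrow> real) \<times> (nat \<Rightarrow> nat \<Rightarrow> real) \<Rightarrow> real) \<Rightarrow>
    (nat \<Rightarrow> nat \<Rightarrow> real) \<times> (nat \<Rightarrow> nat \<Rightarrow> real) \<Rightarrow> nat \<Rightarrow> nat \<Rightarrow> real" where
  "aligned e z = (\<lambda>j i. e z * snd z j i)"

text \<open>The flag False marks antipodality of \<open>x\<close> and the aligned target in factor
  \<open>j\<close>; the value 1 means antipodal. The flag True marks closeness of the target to the
  poles; the value 1 means a zero of the skew field when \<open>n j\<close> is even.\<close>

definition defect where
  "defect n e z a = (case a of (j, b) \<Rightarrow>
     if b then (aligned e z j (n j))\<^sup>2 else - dot (n j) (fst z j) (aligned e z j))"

definition defect_indices :: "(nat \<Rightarrow> nat) \<Rightarrow> nat \<Rightarrow> (nat \<times> bool) set" where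
  "defect_indices n r = {1..<r} \<times> {False} \<union> {j. 1 \<le> j \<and> j < r \<and> even (n j)} \<times> {True}"

text \<open>The bound by 1 is stated apart from the comparison because for empty \<open>D\<close>
  the comparison says nothing.\<close>

definition stratum where
  "stratum n r e Z D = {z \<in> Z. (\<forall>a\<in>D. defect n e z a > 0) \<and>
     (\<forall>b\<in>defect_indices n r - D. defect n e z b < 1 \<and> (\<forall>a\<in>D. defect n e z b < defect n e z a))}"

definition detour_direction :: "(nat \<Rightarrow> nat) \<Rightarrow> (nat \<times> bool) set \<Rightarrow> nat \<Rightarrow> (nat \<Rightarrow> real) \<Rightarrow> nat \<Rightarrow> real" where
  "detour_direction n D j v =
     (if (j, True) \<in> D then (\<lambda>i. if i = 0 then v (n j) else 0) else skew (n j) v)"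

definition factor_path :: "(nat \<Rightarrow> nat) \<Rightarrow> (nat \<times> bool) set \<Rightarrow> nat \<Rightarrow> real \<Rightarrow>
    (nat \<Rightarrow> real) \<Rightarrow> (nat \<Rightarrow> real) \<Rightarrow> nat \<Rightarrow> real" where
  "factor_path n D j t u v =
     (if (j, False) \<in> D then detour_path t u v (detour_direction n D j v) else line_path t u v)"

lemma finite_defect_indices: "finite (defect_indices n r)"
  by (auto simp: defect_indices_def)

text \<open>Adding 1 turns the number of defects into the number of possible cardinalities of a set
  of defects.\<close>

lemma card_defect_indices:
  assumes "1 \<le> r"
  shows "card (defect_indices n r) + 1 = r + card {i. 1 \<le> i \<and> i < r \<and> even (n i)}"
proof -
  have "card (defect_indices n r) =
      card ({1..<r} \<times> {False}) + card ({j. 1 \<le> j \<and> j < r \<and> even (n j)} \<times> {True})"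
    unfolding defect_indices_def by (rule card_Un_disjoint) auto
  then show ?thesis using assms by (simp add: card_cartesian_product)
qed

lemma factor_path_minus:
  "factor_path n D j t (\<lambda>i. - u i) (\<lambda>i. - v i) = (\<lambda>i. - factor_path n D j t u v i)"
  by (auto simp: factor_path_def detour_path_def line_path_def detour_direction_def skew_def
      fun_eq_iff algebra_simps)

lemma factor_path_0: "factor_path n D j 0 u v = u"
  and factor_path_1: "factor_path n D j 1 u v = v"
  by (auto simp: factor_path_def detour_path_def line_path_def fun_eq_iff)

lemma factor_path_above:
  assumes "u \<in> sphere_set (n j)" "v \<in> sphere_set (n j)" "i > n j"
  shows "factor_path n D j t u v i = 0"
  using assms by (auto simp: factor_path_def detour_path_def line_path_def detour_direction_def
      skew_def sphere_set_def)

lemma continuous_on_factor_path: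
  fixes f :: "'a::topological_space \<Rightarrow> real"
  assumes f: "continuous_on A f" and u: "\<And>i. continuous_on A (\<lambda>w. u w i)"
    and v: "\<And>i. continuous_on A (\<lambda>w. v w i)"
  shows "continuous_on A (\<lambda>w. factor_path n D j (f w) (u w) (v w) i)"
proof -
  have d: "continuous_on A (\<lambda>w. detour_direction n D j (v w) i)"
    unfolding detour_direction_def skew_def
    by (cases "(j, True) \<in> D"; cases "i = 0"; cases "i > n j"; cases "even i")
      (simp_all add: v continuous_on_minus)
  show ?thesis
  proof (cases "(j, False) \<in> D")
    case True
    then show ?thesis unfolding factor_path_def detour_path_def
      by (simp only: if_True) (intro continuous_intros f u v d)
  next
    case False
    then show ?thesis unfolding factor_path_def line_path_def
      by (simp only: if_False) (intro continuous_intros f u v)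
  qed
qed

section \<open>Invariance and continuity of the defects\<close>

lemma aligned_in:
  assumes "lifted_planner n r Z K e" "z \<in> Z"
  shows "fst z \<in> prod_spheres_set n r" "snd z \<in> prod_spheres_set n r"
    "aligned e z = snd z \<or> aligned e z = antipode (snd z)" "aligned e z \<in> prod_spheres_set n r"
proof -
  have "Z \<subseteq> prod_spheres_set n r \<times> prod_spheres_set n r" "e ` Z \<subseteq> {1, -1}"
    using assms(1) unfolding lifted_planner_def by (auto dest: openin_imp_subset)
  then have z: "fst z \<in> prod_spheres_set n r" "snd z \<in> prod_spheres_set n r" "e z = 1 \<or> e z = -1"
    using assms(2) by auto
  show "fst z \<in> prod_spheres_set n r" "snd z \<in> prod_spheres_set n r" by fact+
  show *: "aligned e z = snd z \<or> aligned e z = antipode (snd z)"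
    using z(3) by (auto simp: aligned_def fun_eq_iff)
  then show "aligned e z \<in> prod_spheres_set n r" using z(2) by auto
qed

lemma aligned_antipode:
  assumes "lifted_planner n r Z K e" "(x, y) \<in> Z"
  shows "aligned e (antipode x, y) = antipode (aligned e (x, y))"
    "aligned e (x, antipode y) = aligned e (x, y)"
proof -
  have "e (antipode x, y) = - e (x, y)" "e (x, antipode y) = - e (x, y)"
    using assms unfolding lifted_planner_def by simp_all
  then show "aligned e (antipode x, y) = antipode (aligned e (x, y))"
    "aligned e (x, antipode y) = aligned e (x, y)"
    by (simp_all add: aligned_def fun_eq_iff)
qed

text \<open>The defects are quadratic in \<open>x\<close> and the aligned target, which are either
  both negated or both unchanged.\<close>

lemma defect_antipode:
  assumes "lifted_planner n r Z K e" "(x, y) \<in> Z"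
  shows "defect n e (antipode x, y) a = defect n e (x, y) a"
    "defect n e (x, antipode y) a = defect n e (x, y) a"
  using aligned_antipode[OF assms] by (cases a, simp add: defect_def dot_antipode)+

lemma continuous_on_aligned:
  assumes "lifted_planner n r Z K e"
  shows "continuous_on Z (\<lambda>z. aligned e z j i)"
proof -
  have "continuous_on Z e" using assms unfolding lifted_planner_def by (elim conjE)
  then show ?thesis
    unfolding aligned_def
    by (rule continuous_on_mult) (rule continuous_on_coordinate2; intro continuous_intros)
qed

lemma continuous_on_defect:
  assumes "lifted_planner n r Z K e"
  shows "continuous_on Z (\<lambda>z. defect n e z a)"
proof -
  obtain j b where a: "a = (j, b)" by (rule prod.exhaust)
  have x: "continuous_on Z (\<lambda>z. fst z j i)" for i
    by (rule continuous_on_coordinate2; intro continuous_intros)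
  note y = continuous_on_aligned[OF assms]
  show ?thesis
  proof (cases b)
    case True
    then show ?thesis unfolding defect_def a by simp (intro continuous_intros y)
  next
    case False
    then show ?thesis unfolding defect_def a dot_def by simp (intro continuous_intros x y)
  qed
qed

lemma openin_stratum:
  assumes L: "lifted_planner n r Z K e" and D: "finite D"
  shows "openin (top_of_set (prod_spheres_set n r \<times> prod_spheres_set n r)) (stratum n r e Z D)"
proof -
  let ?J = "defect_indices n r"
  have open_less: "openin (top_of_set Z) {z \<in> Z. f z < g z}"
    if "continuous_on Z f" "continuous_on Z g" for f g :: "_ \<Rightarrow> real"
  proof -
    have "openin (top_of_set Z) (Z \<inter> (\<lambda>z. g z - f z) -` {0<..})"
      by (intro continuous_openin_preimage_gen continuous_on_diff that) simp
    also have "Z \<inter> (\<lambda>z. g z - f z) -` {0<..} = {z \<in> Z. f z < g z}" by auto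
    finally show ?thesis .
  qed
  have c: "continuous_on Z (\<lambda>z. defect n e z a)" for a by (rule continuous_on_defect[OF L])
  have const: "continuous_on Z (\<lambda>z. c)" for c :: real by (rule continuous_on_const)
  define T where "T = (\<Inter>a\<in>D. {z \<in> Z. 0 < defect n e z a})"
  define R where "R = (\<Inter>b\<in>?J - D. {z \<in> Z. defect n e z b < 1})"
  define Q where "Q = (\<Inter>p\<in>(?J - D) \<times> D. {z \<in> Z. defect n e z (fst p) < defect n e z (snd p)})"
  \<comment> \<open>Intersecting with the whole space covers empty index sets, over which the
    intersection alone would be everything.\<close>
  have "openin (top_of_set Z) (T \<inter> topspace (top_of_set Z))"
    unfolding T_def by (rule openin_INT[OF D open_less[OF const c]])
  moreover have "openin (top_of_set Z) (R \<inter> topspace (top_of_set Z))"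
    unfolding R_def
    by (rule openin_INT[OF finite_Diff[OF finite_defect_indices] open_less[OF c const]])
  moreover have "openin (top_of_set Z) (Q \<inter> topspace (top_of_set Z))"
    unfolding Q_def
    by (rule openin_INT[OF finite_cartesian_product[OF finite_Diff[OF finite_defect_indices] D]
          open_less[OF c c]])
  moreover have "stratum n r e Z D = (T \<inter> topspace (top_of_set Z)) \<inter> (R \<inter> topspace (top_of_set Z)) \<inter>
      (Q \<inter> topspace (top_of_set Z))"
    by (auto simp: stratum_def T_def R_def Q_def)
  ultimately have "openin (top_of_set Z) (stratum n r e Z D)" by auto
  moreover have "openin (top_of_set (prod_spheres_set n r \<times> prod_spheres_set n r)) Z"
    using L unfolding lifted_planner_def by (elim conjE)
  ultimately show ?thesis by (rule openin_trans)
qed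

text \<open>If the antipodality defect of factor \<open>j\<close> is below \<open>1\<close>, a straight line works. Otherwise the
  point first moves to the antipode of its target and then takes a detour, in a direction given by
  the skew field or, near the zeros \<open>\<plusminus>e\<^sub>n\<close> of that field on an even sphere, \<open>y\<^sub>n e\<^sub>0\<close>.\<close>

lemma factor_path_nonzero:
  assumes L: "lifted_planner n r Z K e" and z: "z \<in> stratum n r e Z D"
    and j: "1 \<le> j" "j < r" "1 \<le> n j" and t: "t \<in> {0..1}"
  shows "\<exists>i\<le>n j. factor_path n D j t (fst z j) (aligned e z j) i \<noteq> 0"
proof -
  have zZ: "z \<in> Z" using z by (simp add: stratum_def)
  have u: "fst z j \<in> sphere_set (n j)" and v: "aligned e z j \<in> sphere_set (n j)"
    using aligned_in[OF L zZ] j by (simp_all add: prod_spheres_set_def)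
  show ?thesis
  proof (cases "(j, False) \<in> D")
    case False
    then have "(j, False) \<in> defect_indices n r - D" using j by (simp add: defect_indices_def)
    then have "defect n e z (j, False) < 1" using z unfolding stratum_def by blast
    then have "- dot (n j) (fst z j) (aligned e z j) < 1" by (simp add: defect_def)
    from line_path_nonzero[OF u v this] False show ?thesis by (simp add: factor_path_def)
  next
    case True
    then have "defect n e z (j, False) > 0" using z unfolding stratum_def by blast
    then have neg: "dot (n j) (fst z j) (aligned e z j) < 0" by (simp add: defect_def)
    \<comment> \<open>It remains to see that the detour direction is not a multiple of the target:
      by a nonzero last coordinate if (\<open>j\<close>, True) lies in \<open>D\<close>, and
      otherwise because the target is no zero of the skew field.\<close>
    have "c = 0"
      if eq: "\<And>i. i \<le> n j \<Longrightarrow> b * aligned e z j i + c * detour_direction n D j (aligned e z j) i = 0" for b c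
    proof (cases "(j, True) \<in> D")
      case True
      then have "defect n e z (j, True) > 0" using z unfolding stratum_def by blast
      then have "aligned e z j (n j) \<noteq> 0" by (auto simp: defect_def)
      then show ?thesis
        by (rule pole_independent[where v = "aligned e z j" and m = "n j" and b = b])
          (use j(3) eq True in \<open>simp_all add: detour_direction_def\<close>)
    next
      case False
      have "odd (n j) \<or> (aligned e z j (n j))\<^sup>2 < 1"
      proof (cases "odd (n j)")
        case even: False
        then have "(j, True) \<in> defect_indices n r - D" using j False by (simp add: defect_indices_def)
        then have "defect n e z (j, True) < 1" using z unfolding stratum_def by blast
        then show ?thesis by (simp add: defect_def)
      qed simp
      from skew_independent[OF v this, of b c] eq False show ?thesis
        by (simp add: detour_direction_def)
    qed
    then have "\<exists>i\<le>n j. detour_path t (fst z j) (aligned e z j) (detour_direction n D j (aligned e z j)) i \<noteq> 0"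
      using t by (intro detour_path_nonzero[OF u v neg]) auto
    then show ?thesis using True by (simp add: factor_path_def)
  qed
qed

text \<open>Factor 0 follows the lifted planner and each other factor its normalized path towards
  the aligned target. All ingredients are odd, so the result is negated with \<open>x\<close> and
  unchanged under the antipode of \<open>y\<close>.\<close>

lemma equivariant_planner_stratum:
  assumes L: "lifted_planner n r Z K e" and D: "finite D" and r: "0 < r"
    and n: "\<And>j. j < r \<Longrightarrow> 1 \<le> n j"
  shows "\<exists>G. equivariant_planner n r (stratum n r e Z D) G"
proof -
  let ?S = "prod_spheres_set n r" and ?I = "{0..1::real}" and ?V = "stratum n r e Z D"
  have VZ: "z \<in> Z" if "z \<in> ?V" for z using that by (simp add: stratum_def)
  define F where "F j w = normalized (n j) (factor_path n D j (snd w) (fst (fst w) j) (aligned e (fst w) j))" for j w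
  define G where "G w = (\<lambda>j. if j = 0 then K w else if j < r then F j w else (\<lambda>_. 0))" for w
  have K: "continuous_on (Z \<times> ?I) (\<lambda>w. K w i)" "K ` (Z \<times> ?I) \<subseteq> sphere_set (n 0)" for i
    using L unfolding lifted_planner_def by simp_all
  have KL: "K ((x, y), 0) = x 0" "K ((x, y), 1) = aligned e (x, y) 0" if "(x, y) \<in> Z" for x y
    using L that unfolding lifted_planner_def aligned_def by simp_all
  have KA: "K ((antipode x, y), t) = (\<lambda>i. - K ((x, y), t) i)" "K ((x, antipode y), t) = K ((x, y), t)"
    if "(x, y) \<in> Z" "t \<in> ?I" for x y t
    using L that unfolding lifted_planner_def by simp_all
  have in_S: "x j \<in> sphere_set (n j)" if "x \<in> ?S" "j < r" for x j
    using that by (simp add: prod_spheres_set_def)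
  have nz: "\<exists>i\<le>n j. factor_path n D j (snd w) (fst (fst w) j) (aligned e (fst w) j) i \<noteq> 0"
    if "w \<in> ?V \<times> ?I" "j \<noteq> 0" "j < r" for w j
    by (rule factor_path_nonzero[OF L]) (use that n in auto)
  have FS: "F j w \<in> sphere_set (n j)" if "w \<in> ?V \<times> ?I" "j \<noteq> 0" "j < r" for w j
    unfolding F_def
  proof (rule normalized_in_sphere_set[OF nz[OF that]])
    have "fst w \<in> Z" using that(1) VZ by auto
    note z = aligned_in[OF L this]
    show "factor_path n D j (snd w) (fst (fst w) j) (aligned e (fst w) j) i = 0" if "i > n j" for i
      using in_S[OF z(1) \<open>j < r\<close>] in_S[OF z(4) \<open>j < r\<close>] that by (rule factor_path_above)
  qed
  have GS: "G ` (?V \<times> ?I) \<subseteq> ?S"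
  proof (rule image_subsetI)
    fix w assume w: "w \<in> ?V \<times> ?I"
    then have "w \<in> Z \<times> ?I" using VZ by auto
    then have "K w \<in> sphere_set (n 0)" using K(2) by blast
    then show "G w \<in> ?S" using FS[OF w] r by (simp add: prod_spheres_set_def G_def)
  qed
  have sub: "?V \<times> ?I \<subseteq> Z \<times> ?I" using VZ by auto
  have Gc: "continuous_on (?V \<times> ?I) G"
  proof (rule continuous_on_coordinatewise_then_product, rule continuous_on_coordinatewise_then_product)
    fix j i
    have "continuous_on (?V \<times> ?I) (\<lambda>w. F j w i)" if j: "j \<noteq> 0" "j < r"
    proof -
      have x: "continuous_on (?V \<times> ?I) (\<lambda>w. fst (fst w) j i)" for i
        by (rule continuous_on_coordinate2; intro continuous_intros)
      have y: "continuous_on (?V \<times> ?I) (\<lambda>w. aligned e (fst w) j i)" for i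
        by (rule continuous_on_compose2[OF continuous_on_aligned[OF L] continuous_on_fst[OF continuous_on_id]])
          (use VZ in auto)
      show ?thesis
        unfolding F_def
        by (intro continuous_on_normalized continuous_on_factor_path x y continuous_on_snd continuous_on_id nz j)
    qed
    then show "continuous_on (?V \<times> ?I) (\<lambda>w. G w j i)"
      using continuous_on_subset[OF K(1) sub] unfolding G_def
      by (cases "j = 0"; cases "j < r") simp_all
  qed
  have "equivariant_planner n r ?V G"
    unfolding equivariant_planner_def
  proof (intro conjI allI impI)
    show "openin (top_of_set (?S \<times> ?S)) ?V" by (rule openin_stratum[OF L D])
    show "continuous_on (?V \<times> ?I) G" "G ` (?V \<times> ?I) \<subseteq> ?S" by fact+
  next
    fix x y assume xy: "(x, y) \<in> ?V"
    note xyZ = VZ[OF xy]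
    have "(antipode x, y) \<in> Z" "(x, antipode y) \<in> Z"
      using L xyZ unfolding lifted_planner_def by simp_all
    then show "(antipode x, y) \<in> ?V" "(x, antipode y) \<in> ?V"
      using xy defect_antipode[OF L xyZ] by (simp_all add: stratum_def)
    note z = aligned_in[OF L xyZ]
    have "G ((x, y), 0) = x"
    proof
      \<comment> \<open>With scalar 1, \<open>normalized_scale\<close> says that normalization does
        not move the end points; beyond index \<open>r\<close> both sides are 0.\<close>
      fix j show "G ((x, y), 0) j = x j"
        using z(1) normalized_scale[OF in_S[OF z(1)], of j 1] KL[OF xyZ]
        by (cases "j = 0"; cases "j < r") (simp_all add: G_def F_def factor_path_0 prod_spheres_set_def)
    qed
    then show "proj_point (G ((x, y), 0)) = proj_point x" by simp
    have "G ((x, y), 1) = aligned e (x, y)"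
    proof
      fix j show "G ((x, y), 1) j = aligned e (x, y) j"
        using z(4) normalized_scale[OF in_S[OF z(4)], of j 1] KL[OF xyZ]
        by (cases "j = 0"; cases "j < r") (simp_all add: G_def F_def factor_path_1 prod_spheres_set_def)
    qed
    then show "proj_point (G ((x, y), 1)) = proj_point y" using z(3) unfolding proj_point_eq_iff by simp
    fix t assume t: "t \<in> ?I"
    have "F j ((antipode x, y), t) = (\<lambda>i. - F j ((x, y), t) i)" for j
    proof -
      have neg: "antipode v j = (\<lambda>i. - v j i)" for v by (simp add: antipode_def)
      show ?thesis
        unfolding F_def fst_conv snd_conv aligned_antipode[OF L xyZ] neg factor_path_minus normalized_minus ..
    qed
    then have "G ((antipode x, y), t) = antipode (G ((x, y), t))"
      using KA[OF xyZ t] by (simp add: G_def antipode_def fun_eq_iff)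
    then show "proj_point (G ((antipode x, y), t)) = proj_point (G ((x, y), t))" by simp
    have "F j ((x, antipode y), t) = F j ((x, y), t)" for j
      unfolding F_def fst_conv snd_conv aligned_antipode[OF L xyZ] ..
    then have "G ((x, antipode y), t) = G ((x, y), t)"
      using KA[OF xyZ t] by (simp add: G_def fun_eq_iff)
    then show "proj_point (G ((x, antipode y), t)) = proj_point (G ((x, y), t))" by simp
  qed
  then show ?thesis by blast
qed

text \<open>Distinct finite sets of equal size each contain an element missing from the other; at a
  common point the defects of these two elements would each be smaller than the other.\<close>

lemma stratum_disjoint:
  assumes "D \<subseteq> defect_indices n r" "D' \<subseteq> defect_indices n r" "card D = card D'" "D \<noteq> D'"
  shows "stratum n r e Z D \<inter> stratum n r e Z D' = {}"
proof -
  have fin: "finite D" "finite D'"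
    using assms(1,2) finite_defect_indices finite_subset by blast+
  have "\<not> D \<subseteq> D'" "\<not> D' \<subseteq> D"
    using assms(3,4) fin card_subset_eq by metis+
  then obtain a b where ab: "a \<in> D" "a \<notin> D'" "b \<in> D'" "b \<notin> D" by blast
  show ?thesis
  proof (rule equals0I)
    fix z assume z: "z \<in> stratum n r e Z D \<inter> stratum n r e Z D'"
    have "defect n e z b < defect n e z a" "defect n e z a < defect n e z b"
      using z ab assms(1,2) unfolding stratum_def by blast+
    then show False by simp
  qed
qed

text \<open>A single squared coordinate is at most the squared norm, and the squared norm of the sum
  of two unit vectors is nonnegative.\<close>

lemma defect_le_1:
  assumes "lifted_planner n r Z K e" "z \<in> Z" "a \<in> defect_indices n r"
  shows "defect n e z a \<le> 1"
proof -
  obtain j b where a: "a = (j, b)" by (rule prod.exhaust)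
  have j: "j < r" using assms(3) by (auto simp: a defect_indices_def)
  note z = aligned_in[OF assms(1,2)]
  have u: "fst z j \<in> sphere_set (n j)" and v: "aligned e z j \<in> sphere_set (n j)"
    using z j by (simp_all add: prod_spheres_set_def)
  show ?thesis
  proof (cases b)
    case True
    have "(aligned e z j (n j))\<^sup>2 \<le> (\<Sum>i\<le>n j. (aligned e z j i)\<^sup>2)"
      by (rule member_le_sum) auto
    then show ?thesis using v True by (simp add: a defect_def sphere_set_def)
  next
    case False
    have "0 \<le> (\<Sum>i\<le>n j. (fst z j i + aligned e z j i)\<^sup>2)" by (intro sum_nonneg) simp
    also have "\<dots> = 1 + 1 + 2 * dot (n j) (fst z j) (aligned e z j)"
      using u v by (simp add: sphere_set_def power2_sum sum.distrib dot_def sum_distrib_left mult.assoc)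
    finally show ?thesis using False by (simp add: a defect_def)
  qed
qed

text \<open>Since 1 is the largest possible value, the defects outside the set of those equal to 1
  are strictly smaller.\<close>

lemma stratum_cover:
  assumes "lifted_planner n r Z K e" "z \<in> Z"
  shows "z \<in> stratum n r e Z {a \<in> defect_indices n r. defect n e z a = 1}"
  using assms defect_le_1[OF assms] by (auto simp: stratum_def order_less_le)

section \<open>The final cover and its cardinality\<close>

theorem theorem3p9:
  fixes n :: "nat \<Rightarrow> nat" and r :: nat
  assumes "1 \<le> r"
    and "1 \<le> n 0"
    and "\<And>i j. i \<le> j \<Longrightarrow> j < r \<Longrightarrow> n i \<le> n j"
  shows "TC (proj_product n r)
     < (TC (real_proj_space (n 0)) + 1) * enat (r + card {i. 1 \<le> i \<and> i < r \<and> even (n i)})"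
proof -
  let ?P = "real_proj_space (n 0)" and ?S = "prod_spheres_set n r"
  let ?J = "defect_indices n r"
  have r: "0 < r" using assms(1) by simp
  have n: "1 \<le> n j" if "j < r" for j using assms(2) assms(3)[of 0 j] that by simp
  obtain t where t: "TC ?P = enat t" using TC_real_proj_space_finite[of "n 0"] by (cases "TC ?P") auto
  then obtain U where U: "\<And>i. i \<le> t \<Longrightarrow> openin (prod_topology ?P ?P) (U i)"
    "\<And>i. i \<le> t \<Longrightarrow> \<exists>s. motion_planner ?P (U i) s"
    "topspace (prod_topology ?P ?P) \<subseteq> (\<Union>i\<le>t. U i)"
    by (rule TC_eq_enatE) blast
  define Z where "Z i = {(x, y) \<in> ?S \<times> ?S. (proj_point (first_factor x), proj_point (first_factor y)) \<in> U i}" for i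
  \<comment> \<open>The sign functions are chosen once for all, because the strata depend on them;
    the paths \<open>K\<close> enter only the existence of planners.\<close>
  have "\<forall>i\<in>{..t}. \<exists>e. \<exists>K. lifted_planner n r (Z i) K e"
  proof
    fix i assume "i \<in> {..t}"
    then obtain s where "openin (prod_topology ?P ?P) (U i)" "motion_planner ?P (U i) s"
      using U(1,2)[of i] by auto
    from lifted_planner_exists[where n = n, OF r this] show "\<exists>e. \<exists>K. lifted_planner n r (Z i) K e"
      unfolding Z_def by blast
  qed
  from bchoice[OF this] obtain e where e: "\<And>i. i \<le> t \<Longrightarrow> \<exists>K. lifted_planner n r (Z i) K (e i)"
    by auto
  \<comment> \<open>One open set for each set of the given cover and each cardinality
    \<open>c\<close>: the strata of all \<open>D\<close> with \<open>c\<close> elements are merged.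
    With \<open>c\<close> from 0 to \<open>card ?J\<close> this makes
    \<open>(t + 1) * (card ?J + 1)\<close> sets.\<close>
  define W where "W = (\<lambda>(i, c). \<Union>D\<in>{D. D \<subseteq> ?J \<and> card D = c}. stratum n r (e i) (Z i) D)"
  have "TC (proj_product n r) < enat (card ({..t} \<times> {..card ?J}))"
  proof (rule TC_proj_product_less_card[where W = W])
    fix a assume "a \<in> {..t} \<times> {..card ?J}"
    then obtain i c where a: "a = (i, c)" "i \<le> t" by auto
    obtain K where L: "lifted_planner n r (Z i) K (e i)" using e[OF a(2)] by blast
    have "\<forall>D. \<exists>G. D \<subseteq> ?J \<longrightarrow> equivariant_planner n r (stratum n r (e i) (Z i) D) G"
      using equivariant_planner_stratum[OF L _ r n] finite_subset[OF _ finite_defect_indices] by blast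
    from choice[OF this] obtain G
      where "\<And>D. D \<subseteq> ?J \<Longrightarrow> equivariant_planner n r (stratum n r (e i) (Z i) D) (G D)" by auto
    then have "\<exists>G. equivariant_planner n r
        (\<Union>D\<in>{D. D \<subseteq> ?J \<and> card D = c}. stratum n r (e i) (Z i) D) G"
      by (intro equivariant_planner_UN[where G = G] stratum_disjoint) simp_all
    then show "\<exists>G. equivariant_planner n r (W a) G" by (simp add: W_def a)
  next
    show "?S \<times> ?S \<subseteq> (\<Union>a\<in>{..t} \<times> {..card ?J}. W a)"
    proof
      fix z assume z: "z \<in> ?S \<times> ?S"
      then obtain x y where xy: "z = (x, y)" "x \<in> ?S" "y \<in> ?S" by auto
      \<comment> \<open>The cover of pairs of points of projective space is pulled back through the
        first factors, so every pair of points of the product of spheres lies in some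
        \<open>Z i\<close>.\<close>
      have "(proj_point (first_factor x), proj_point (first_factor y)) \<in> topspace (prod_topology ?P ?P)"
        using xy first_factor_in[OF _ r] by (simp add: real_proj_space_def topspace_proj_product)
      then obtain i where i: "i \<le> t" "z \<in> Z i" using U(3) xy by (auto simp: Z_def)
      obtain K where L: "lifted_planner n r (Z i) K (e i)" using e[OF i(1)] by blast
      define D where "D = {a \<in> ?J. defect n (e i) z a = 1}"
      have DJ: "D \<subseteq> ?J" by (auto simp: D_def)
      then have "card D \<le> card ?J" by (rule card_mono[OF finite_defect_indices])
      moreover have "z \<in> W (i, card D)"
        using stratum_cover[OF L i(2)] DJ unfolding D_def[symmetric] by (auto simp: W_def)
      ultimately show "z \<in> (\<Union>a\<in>{..t} \<times> {..card ?J}. W a)"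
        using i(1) by (intro UN_I[of "(i, card D)"]) simp_all
    qed
  qed auto
  also have "card ({..t} \<times> {..card ?J}) = (t + 1) * (card ?J + 1)"
    by (simp add: card_cartesian_product)
  also have "card ?J + 1 = r + card {i. 1 \<le> i \<and> i < r \<and> even (n i)}"
    by (rule card_defect_indices[OF assms(1)])
  finally show ?thesis
    by (simp add: t one_enat_def)
qed

end
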